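(* Let $\mathcal K=(K,\mathcal F(K))$ be a field of definable characteristic zero and $\mathbf N=\mathbf N(\mathcal K)$. There is a function $(n,x)\mapsto x^n$ from $\mathbf N\times K$ to $K$, definable in $\mathcal K^{eq}$, such that for all $x\in K$ and $n\in\mathbf N$: - $x^0=1$, - $x^{n+1}=x^nx$. In a similar way, one can define (in $\mathcal K^{eq}$, uniformly in $n\in\mathbf N$ and $h\in K^{(n)}$) the iterated products $\prod_{m<n}h(m)\in K$, satisfying $\prod_{m<0}h(m)=1$ and $\prod_{m<j+1}h(m)=\bigl(\prod_{m<j}h(m)\bigr)h(j)$ for $j<n$.
   Context: "Definable" means first-order definable with parameters. Let $X,Y$ be definable sets in a structure and $\in^*\subseteq X\times Y$ a definable relation. $Y$ is a definable finite power set of $X$ with respect to $\in^*$ (written $\mathcal F(X)=Y$) if: (i) $B,C\in\mathcal F(X)$ are equal iff for all $x\in X$, $x\in^* B\iff x\in^* C$; (ii) there is $\emptyset^*\in\mathcal F(X)$ with $x\notin^*\emptyset^*$ for all $x\in X$; (iii) for each $a\in X$ there is $\{a\}^*\in\mathcal F(X)$ with $x\in^*\{a\}^*\iff x=a$; (iv) for $B,C\in\mathcal F(X)$ there is $B\cup^*C\in\mathcal F(X)$ with $x\in^* B\cup^* C\iff x\in^*B\lor x\in^*C$; (v) every definable $\mathcal U\subseteq\mathcal F(X)$ such that $\emptyset^*\in\mathcal U$ and $B\cup^*\{x\}^*\in\mathcal U$ for all $B\in\mathcal U$, $x\in X$, equals $\mathcal F(X)$. For $a\in\mathcal F(X)$,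 the extension of $a$ is $\{x\in X:x\in^*a\}$. Consider structures $\mathcal K=(K,\mathcal F(K))$ with a field sort $K$, a second sort $\mathcal F(K)$ and a relation $\in^*$ making $\mathcal F(K)$ a definable finite power set of $K$. Let $K_0$ be the set of $x\in K$ for which there is $F\in\mathcal F(K)$ with $x\in^*F$ and, for all $z\in^* F$, if $z\ne0$ then $z-1\in^*F$. $\mathcal K$ has definable characteristic zero if $-1\notin K_0$. In that case put $\mathbf N(\mathcal K)=K_0$, which with $+,\cdot$ is a model of Peano Arithmetic (ordered by $x\le y\iff y-x\in\mathbf N$) satisfying induction for all $\mathcal K$-definable subsets. In $\mathcal K^{eq}$ (Shelah's expansion of $\mathcal K$ by sorts for quotients by $\emptyset$-definable equivalence relations) every definable set $X$ has a definable finite power set $\mathcal F(X)$, unique up to a definable bijection preserving extensions. For $n\in\mathbf N$, $(n)=\{i\in\mathbf N:i<n\}$, and $K^{(n)}$ is the definable set of those elements of $\mathcal F((n)\times K)$ whose extension is (the graph of) a total function $(n)\to K$; such elements are identified with the corresponding functions. *)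

theory Defs
  imports Main
begin

section \<open>Many-sorted first-order logic\<close>

text \<open>Every sort has its own supply of variables: \<open>Var s n\<close> is the \<open>n\<close>-th variable of sort \<open>s\<close>.\<close>

datatype ('s, 'f) trm = Var 's nat | App 'f "('s, 'f) trm list"

datatype ('s, 'f, 'r) form =
    FEq "('s, 'f) trm" "('s, 'f) trm"
  | FRel 'r "('s, 'f) trm list"
  | FNot "('s, 'f, 'r) form"
  | FAnd "('s, 'f, 'r) form" "('s, 'f, 'r) form"
  | FEx 's nat "('s, 'f, 'r) form"

text \<open>
  A record bundles a signature (the first four fields) with an interpretation. All sorts live in
  one type \<open>'u\<close>; the sorts need not be disjoint, since formulas only compare
  elements of the same sort. Only the elements of \<open>sorts\<close> are sorts of the structure; symbols
  involving any other value of type \<open>'s\<close> do not occur in well-formed formulas.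
\<close>

record ('s, 'f, 'r, 'u) mstruct =
  sorts :: "'s set"
  fargs :: "'f \<Rightarrow> 's list"
  fres :: "'f \<Rightarrow> 's"
  rargs :: "'r \<Rightarrow> 's list"
  univ :: "'s \<Rightarrow> 'u set"
  fint :: "'f \<Rightarrow> 'u list \<Rightarrow> 'u"
  rint :: "'r \<Rightarrow> 'u list \<Rightarrow> bool"

fun sort_of :: "('s, 'f, 'r, 'u) mstruct \<Rightarrow> ('s, 'f) trm \<Rightarrow> 's" where
  "sort_of M (Var s n) = s"
| "sort_of M (App f ts) = fres M f"

fun wf_trm :: "('s, 'f, 'r, 'u) mstruct \<Rightarrow> ('s, 'f) trm \<Rightarrow> bool" where
  "wf_trm M (Var s n) \<longleftrightarrow> s \<in> sorts M"
| "wf_trm M (App f ts) \<longleftrightarrow>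
     fres M f \<in> sorts M \<and> map (sort_of M) ts = fargs M f \<and> (\<forall>t \<in> set ts. wf_trm M t)"

fun wf_form :: "('s, 'f, 'r, 'u) mstruct \<Rightarrow> ('s, 'f, 'r) form \<Rightarrow> bool" where
  "wf_form M (FEq t u) \<longleftrightarrow> wf_trm M t \<and> wf_trm M u \<and> sort_of M t = sort_of M u"
| "wf_form M (FRel r ts) \<longleftrightarrow> map (sort_of M) ts = rargs M r \<and> (\<forall>t \<in> set ts. wf_trm M t)"
| "wf_form M (FNot p) \<longleftrightarrow> wf_form M p"
| "wf_form M (FAnd p q) \<longleftrightarrow> wf_form M p \<and> wf_form M q"
| "wf_form M (FEx s n p) \<longleftrightarrow> s \<in> sorts M \<and> wf_form M p"

fun fv_trm :: "('s, 'f) trm \<Rightarrow> ('s \<times> nat) set" where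
  "fv_trm (Var s n) = {(s, n)}"
| "fv_trm (App f ts) = (\<Union>t \<in> set ts. fv_trm t)"

fun fv :: "('s, 'f, 'r) form \<Rightarrow> ('s \<times> nat) set" where
  "fv (FEq t u) = fv_trm t \<union> fv_trm u"
| "fv (FRel r ts) = (\<Union>t \<in> set ts. fv_trm t)"
| "fv (FNot p) = fv p"
| "fv (FAnd p q) = fv p \<union> fv q"
| "fv (FEx s n p) = fv p - {(s, n)}"

fun val :: "('s, 'f, 'r, 'u) mstruct \<Rightarrow> ('s \<Rightarrow> nat \<Rightarrow> 'u) \<Rightarrow> ('s, 'f) trm \<Rightarrow> 'u" where
  "val M e (Var s n) = e s n"
| "val M e (App f ts) = fint M f (map (val M e) ts)"

fun sat :: "('s, 'f, 'r, 'u) mstruct \<Rightarrow> ('s \<Rightarrow> nat \<Rightarrow> 'u) \<Rightarrow> ('s, 'f, 'r) form \<Rightarrow> bool" where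
  "sat M e (FEq t u) \<longleftrightarrow> val M e t = val M e u"
| "sat M e (FRel r ts) \<longleftrightarrow> rint M r (map (val M e) ts)"
| "sat M e (FNot p) \<longleftrightarrow> \<not> sat M e p"
| "sat M e (FAnd p q) \<longleftrightarrow> sat M e p \<and> sat M e q"
| "sat M e (FEx s n p) \<longleftrightarrow> (\<exists>a \<in> univ M s. sat M (e(s := (e s)(n := a))) p)"


section \<open>Definable sets\<close>

definition tuples :: "('s, 'f, 'r, 'u) mstruct \<Rightarrow> 's list \<Rightarrow> 'u list set" where
  "tuples M ss = {xs. list_all2 (\<lambda>x s. x \<in> univ M s) xs ss}"

text \<open>The \<open>i\<close>-th coordinate of a tuple of sorts \<open>ss\<close> is denoted by the variable \<open>Var (ss ! i) i\<close>.\<close>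

definition tuple_vars :: "'s list \<Rightarrow> ('s \<times> nat) set" where
  "tuple_vars ss = {(ss ! i, i) | i. i < length ss}"

definition assign ::
  "('s \<Rightarrow> nat \<Rightarrow> 'u) \<Rightarrow> 's list \<Rightarrow> 'u list \<Rightarrow> 's \<Rightarrow> nat \<Rightarrow> 'u" where
  "assign e ss xs = (\<lambda>s n. if n < length ss \<and> ss ! n = s then xs ! n else e s n)"

text \<open>
  Definability with parameters: the parameters are the values under \<open>e\<close> of the
  free variables that do not denote coordinates.
\<close>

definition definable :: "('s, 'f, 'r, 'u) mstruct \<Rightarrow> 's list \<Rightarrow> 'u list set \<Rightarrow> bool" where
  "definable M ss X \<longleftrightarrow> set ss \<subseteq> sorts M \<and>
     (\<exists>p e. wf_form M p \<and> (\<forall>(s, n) \<in> fv p - tuple_vars ss. e s n \<in> univ M s) \<and>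
        X = {xs \<in> tuples M ss. sat M (assign e ss xs) p})"

definition definable_finite_power_set ::
  "('s, 'f, 'r, 'u) mstruct \<Rightarrow> 's list \<Rightarrow> 'u list set \<Rightarrow> 's list \<Rightarrow> 'u list set \<Rightarrow>
   ('u list \<times> 'u list) set \<Rightarrow> bool" where
  "definable_finite_power_set M ss X tt Y R \<longleftrightarrow>
     definable M ss X \<and> definable M tt Y \<and>
     R \<subseteq> X \<times> Y \<and> definable M (ss @ tt) {x @ y | x y. (x, y) \<in> R} \<and>
     (\<forall>B \<in> Y. \<forall>C \<in> Y. B = C \<longleftrightarrow> (\<forall>x \<in> X. (x, B) \<in> R \<longleftrightarrow> (x, C) \<in> R)) \<and>
     (\<exists>emp sing un.
        emp \<in> Y \<and> (\<forall>x \<in> X. (x, emp) \<notin> R) \<and>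
        (\<forall>a \<in> X. sing a \<in> Y \<and> (\<forall>x \<in> X. (x, sing a) \<in> R \<longleftrightarrow> x = a)) \<and>
        (\<forall>B \<in> Y. \<forall>C \<in> Y. un B C \<in> Y \<and>
           (\<forall>x \<in> X. (x, un B C) \<in> R \<longleftrightarrow> (x, B) \<in> R \<or> (x, C) \<in> R)) \<and>
        (\<forall>U. definable M tt U \<and> U \<subseteq> Y \<and> emp \<in> U \<and> (\<forall>B \<in> U. \<forall>x \<in> X. un B (sing x) \<in> U)
           \<longrightarrow> U = Y))"


section \<open>Shelah's expansion\<close>

definition form_rel ::
  "('s, 'f, 'r, 'u) mstruct \<Rightarrow> 's list \<Rightarrow> ('s, 'f, 'r) form \<Rightarrow> ('u list \<times> 'u list) set" where
  "form_rel M ss p = {(xs, ys). xs \<in> tuples M ss \<and> ys \<in> tuples M ss \<and>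
     sat M (assign (\<lambda>_ _. undefined) (ss @ ss) (xs @ ys)) p}"

text \<open>
  The formulas defining, without parameters, an equivalence relation on the product of the sorts
  \<open>ss\<close>. By the condition on free variables, the value \<open>undefined\<close> above is never used.
\<close>

definition equiv_form :: "('s, 'f, 'r, 'u) mstruct \<Rightarrow> 's list \<Rightarrow> ('s, 'f, 'r) form \<Rightarrow> bool" where
  "equiv_form M ss p \<longleftrightarrow> set ss \<subseteq> sorts M \<and> wf_form M p \<and> fv p \<subseteq> tuple_vars (ss @ ss) \<and>
     equiv (tuples M ss) (form_rel M ss p)"

datatype ('s, 'f, 'r) eqsort = Home 's | Quot "'s list" "('s, 'f, 'r) form"

datatype ('s, 'f, 'r) eqfun = HomeFun 'f | Proj "'s list" "('s, 'f, 'r) form"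

datatype 'u eqelem = Real (the_real: 'u) | Class "'u list set"

definition eq_expansion ::
  "('s, 'f, 'r, 'u) mstruct \<Rightarrow>
   (('s, 'f, 'r) eqsort, ('s, 'f, 'r) eqfun, 'r, 'u eqelem) mstruct" where
  "eq_expansion M = \<lparr>
     sorts = Home ` sorts M \<union> {Quot ss p | ss p. equiv_form M ss p},
     fargs = (\<lambda>f. case f of HomeFun g \<Rightarrow> map Home (fargs M g) | Proj ss p \<Rightarrow> map Home ss),
     fres = (\<lambda>f. case f of HomeFun g \<Rightarrow> Home (fres M g) | Proj ss p \<Rightarrow> Quot ss p),
     rargs = (\<lambda>r. map Home (rargs M r)),
     univ = (\<lambda>s. case s of
         Home t \<Rightarrow> Real ` univ M t
       | Quot ss p \<Rightarrow> Class ` (tuples M ss // form_rel M ss p)),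
     fint = (\<lambda>f xs. case f of
         HomeFun g \<Rightarrow> Real (fint M g (map the_real xs))
       | Proj ss p \<Rightarrow> Class (form_rel M ss p `` {map the_real xs})),
     rint = (\<lambda>r xs. rint M r (map the_real xs)) \<rparr>"


section \<open>Fields with a definable finite power set\<close>

datatype ksort = FieldSort | FinSort
datatype kfun = KZero | KOne | KAdd | KNeg | KMult
datatype krel = KMem

definition kstruct ::
  "('a::field \<Rightarrow> 'b \<Rightarrow> bool) \<Rightarrow> (ksort, kfun, krel, 'a + 'b) mstruct" where
  "kstruct mem = \<lparr>
     sorts = UNIV,
     fargs = (\<lambda>f. case f of KZero \<Rightarrow> [] | KOne \<Rightarrow> [] | KNeg \<Rightarrow> [FieldSort]
       | KAdd \<Rightarrow> [FieldSort, FieldSort] | KMult \<Rightarrow> [FieldSort, FieldSort]),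
     fres = (\<lambda>_. FieldSort),
     rargs = (\<lambda>_. [FieldSort, FinSort]),
     univ = (\<lambda>s. case s of FieldSort \<Rightarrow> range Inl | FinSort \<Rightarrow> range Inr),
     fint = (\<lambda>f xs. case f of
         KZero \<Rightarrow> Inl 0
       | KOne \<Rightarrow> Inl 1
       | KNeg \<Rightarrow> Inl (- projl (xs ! 0))
       | KAdd \<Rightarrow> Inl (projl (xs ! 0) + projl (xs ! 1))
       | KMult \<Rightarrow> Inl (projl (xs ! 0) * projl (xs ! 1))),
     rint = (\<lambda>_ xs. mem (projl (xs ! 0)) (projr (xs ! 1))) \<rparr>"

definition finite_power_field :: "('a::field \<Rightarrow> 'b \<Rightarrow> bool) \<Rightarrow> bool" where
  "finite_power_field mem \<longleftrightarrow>
     definable_finite_power_set (kstruct mem)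
       [FieldSort] (tuples (kstruct mem) [FieldSort])
       [FinSort] (tuples (kstruct mem) [FinSort])
       {([Inl x], [Inr F]) | x F. mem x F}"

definition K0 :: "('a::field \<Rightarrow> 'b \<Rightarrow> bool) \<Rightarrow> 'a set" where
  "K0 mem = {x. \<exists>F. mem x F \<and> (\<forall>z. mem z F \<longrightarrow> z \<noteq> 0 \<longrightarrow> mem (z - 1) F)}"

definition definable_char_zero :: "('a::field \<Rightarrow> 'b \<Rightarrow> bool) \<Rightarrow> bool" where
  "definable_char_zero mem \<longleftrightarrow> - 1 \<notin> K0 mem"

text \<open>\<open>N\<close>, a meaningful name only in definable characteristic zero\<close>

abbreviation kN :: "('a::field \<Rightarrow> 'b \<Rightarrow> bool) \<Rightarrow> 'a set" where
  "kN mem \<equiv> K0 mem"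

definition kle :: "('a::field \<Rightarrow> 'b \<Rightarrow> bool) \<Rightarrow> 'a \<Rightarrow> 'a \<Rightarrow> bool" where
  "kle mem x y \<longleftrightarrow> y - x \<in> kN mem"

definition kless :: "('a::field \<Rightarrow> 'b \<Rightarrow> bool) \<Rightarrow> 'a \<Rightarrow> 'a \<Rightarrow> bool" where
  "kless mem x y \<longleftrightarrow> kle mem x y \<and> x \<noteq> y"

definition kseg :: "('a::field \<Rightarrow> 'b \<Rightarrow> bool) \<Rightarrow> 'a \<Rightarrow> 'a set" where
  "kseg mem n = {i \<in> kN mem. kless mem i n}"

type_synonym keqsort = "(ksort, kfun, krel) eqsort"

type_synonym ('a, 'b) keqelem = "('a + 'b) eqelem"

abbreviation keq :: "('a::field \<Rightarrow> 'b \<Rightarrow> bool) \<Rightarrow>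
    (keqsort, (ksort, kfun, krel) eqfun, krel, ('a, 'b) keqelem) mstruct" where
  "keq mem \<equiv> eq_expansion (kstruct mem)"

abbreviation SK :: keqsort where
  "SK \<equiv> Home FieldSort"

abbreviation kel :: "'a \<Rightarrow> ('a, 'b) keqelem" where
  "kel x \<equiv> Real (Inl x)"


section \<open>Internally finite sequences\<close>

text \<open>
  A choice of the finite power sets \<open>F n\<close> of \<open>(n) \<times> K\<close>, with membership relation \<open>R n\<close>, for all
  \<open>n \<in> N\<close>, which is definable uniformly in \<open>n\<close>.
\<close>

definition uniform_power_sets ::
  "('a::field \<Rightarrow> 'b \<Rightarrow> bool) \<Rightarrow> keqsort list \<Rightarrow> ('a \<Rightarrow> ('a, 'b) keqelem list set) \<Rightarrow>
   ('a \<Rightarrow> (('a, 'b) keqelem list \<times> ('a, 'b) keqelem list) set) \<Rightarrow> bool" where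
  "uniform_power_sets mem tt F R \<longleftrightarrow>
     (\<forall>n \<in> kN mem. definable_finite_power_set (keq mem)
        [SK, SK] {[kel i, kel x] | i x. i \<in> kseg mem n} tt (F n) (R n)) \<and>
     definable (keq mem) (SK # tt) {kel n # y | n y. n \<in> kN mem \<and> y \<in> F n} \<and>
     definable (keq mem) (SK # [SK, SK] @ tt)
       {kel n # x @ y | n x y. n \<in> kN mem \<and> (x, y) \<in> R n}"

text \<open>
  \<open>kseqs mem F R n\<close> is \<open>K^(n)\<close>: since \<open>R n\<close> only relates elements of \<open>(n) \<times> K\<close> to elements of \<open>F n\<close>,
  the condition says that the extension of \<open>h\<close> is the graph of a total function \<open>(n) \<rightarrow> K\<close>. Its value
  at \<open>m\<close> is \<open>kapp R n h m\<close>.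
\<close>

definition kseqs ::
  "('a::field \<Rightarrow> 'b \<Rightarrow> bool) \<Rightarrow> ('a \<Rightarrow> ('a, 'b) keqelem list set) \<Rightarrow>
   ('a \<Rightarrow> (('a, 'b) keqelem list \<times> ('a, 'b) keqelem list) set) \<Rightarrow> 'a \<Rightarrow>
   ('a, 'b) keqelem list set" where
  "kseqs mem F R n = {h \<in> F n. \<forall>i \<in> kseg mem n. \<exists>!x. ([kel i, kel x], h) \<in> R n}"

definition kapp ::
  "('a \<Rightarrow> (('a, 'b) keqelem list \<times> ('a, 'b) keqelem list) set) \<Rightarrow> 'a \<Rightarrow>
   ('a, 'b) keqelem list \<Rightarrow> 'a \<Rightarrow> 'a" where
  "kapp R n h m = (THE x. ([kel m, kel x], h) \<in> R n)"

end

theory Submission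
  imports Defs
begin

text \<open>
  Powers and iterated products are computed by recursion along \<open>N\<close>. As in arithmetic, the value at
  \<open>j\<close> is the unique \<open>y\<close> such that \<open>(j, y)\<close> lies in some internally finite relation \<open>r\<close> all of
  whose elements \<open>(i, z)\<close> are justified: either \<open>i = 0\<close> and \<open>z = 1\<close>, or \<open>z\<close> is obtained by one step
  from some \<open>w\<close> with \<open>(i - 1, w)\<close> in \<open>r\<close>. This is first-order, so the graph is definable; existence
  and uniqueness of the value follow by induction for definable subsets of \<open>N\<close>, because the empty
  relation and the addition of one pair are available (\<open>recursion\<close>). Uniqueness at \<open>j + 1\<close>
  follows from uniqueness at \<open>j\<close>, since two justifying relations can be compared one step below.

  What remains is to have enough internally finite relations. For the iterated products the given
  power set of \<open>(n + 1) \<times> K\<close> supplies them. For powers only finite subsets of \<open>K\<close> are available, and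
  a relation inside \<open>A \<times> B\<close>, with \<open>A\<close> and \<open>B\<close> internally finite, is coded by the set of all
  \<open>a + t * b\<close>, for a slope \<open>t\<close> that makes \<open>(a, b) \<mapsto> a + t * b\<close> injective on \<open>A \<times> B\<close>. The bad slopes
  are quotients of differences, hence form a subset of an internally finite set, which cannot be all
  of \<open>K\<close> in definable characteristic zero (\<open>ex_injective_slope\<close>, \<open>pair_mem_insert\<close>).

  Induction on \<open>N\<close> comes from the induction principle of the finite power set of \<open>K\<close>, which is about
  sets definable in \<open>K\<close> with its power set. The products involve sets of tuples of imaginaries, so it
  must be extended to sets definable in the expansion. This is the fact that the expansion induces no
  new structure on the old sorts, proved by replacing a variable of a quotient sort by a tuple of
  variables for a representative (\<open>def_pred_decode\<close>).

  Definability proofs use an inductive, name-free description of definable predicates on tuples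
  (\<open>def_pred\<close>). It agrees with definability by formulas (\<open>definable_def_pred\<close>, \<open>def_pred_definable\<close>),
  and its closure rules can be applied backwards to the predicate to be shown definable.
\<close>

section \<open>Definable predicates without variable names\<close>

definition closed_struct :: "('s, 'f, 'r, 'u) mstruct \<Rightarrow> bool" where
  "closed_struct M \<longleftrightarrow>
     (\<forall>f. \<forall>xs \<in> tuples M (fargs M f). fres M f \<in> sorts M \<longrightarrow> fint M f xs \<in> univ M (fres M f))"

inductive term_fun ::
  "('s, 'f, 'r, 'u) mstruct \<Rightarrow> 's list \<Rightarrow> 's \<Rightarrow> ('u list \<Rightarrow> 'u) \<Rightarrow> bool"
  for M ss where
  coord: "i < length ss \<Longrightarrow> term_fun M ss (ss ! i) (\<lambda>xs. xs ! i)"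
| const: "s \<in> sorts M \<Longrightarrow> c \<in> univ M s \<Longrightarrow> term_fun M ss s (\<lambda>_. c)"
| app: "fres M f \<in> sorts M \<Longrightarrow> list_all2 (term_fun M ss) (fargs M f) gs \<Longrightarrow>
    term_fun M ss (fres M f) (\<lambda>xs. fint M f (map (\<lambda>g. g xs) gs))"
| cong: "term_fun M ss s f \<Longrightarrow> (\<And>xs. xs \<in> tuples M ss \<Longrightarrow> g xs = f xs) \<Longrightarrow> term_fun M ss s g"

text \<open>
  A predicate on tuples whose \<open>i\<close>-th entry has sort \<open>ss ! i\<close>. The quantifier binds a new first entry,
  as for de Bruijn indices, so substitution never meets a name clash. Parameters enter through the
  constant functions among the terms. Both definitions end with a rule \<open>cong\<close> because values outside
  of \<open>tuples M ss\<close> are irrelevant.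
\<close>
inductive def_pred ::
  "('s, 'f, 'r, 'u) mstruct \<Rightarrow> 's list \<Rightarrow> ('u list \<Rightarrow> bool) \<Rightarrow> bool"
  for M where
  eq: "term_fun M ss s f \<Longrightarrow> term_fun M ss s g \<Longrightarrow> def_pred M ss (\<lambda>xs. f xs = g xs)"
| rel: "list_all2 (term_fun M ss) (rargs M r) gs \<Longrightarrow>
    def_pred M ss (\<lambda>xs. rint M r (map (\<lambda>g. g xs) gs))"
| neg: "def_pred M ss P \<Longrightarrow> def_pred M ss (\<lambda>xs. \<not> P xs)"
| conj: "def_pred M ss P \<Longrightarrow> def_pred M ss Q \<Longrightarrow> def_pred M ss (\<lambda>xs. P xs \<and> Q xs)"
| ex: "s \<in> sorts M \<Longrightarrow> def_pred M (s # ss) P \<Longrightarrow>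
    def_pred M ss (\<lambda>xs. \<exists>a \<in> univ M s. P (a # xs))"
| cong: "def_pred M ss P \<Longrightarrow> (\<And>xs. xs \<in> tuples M ss \<Longrightarrow> Q xs = P xs) \<Longrightarrow> def_pred M ss Q"

lemma tuples_Nil: "xs \<in> tuples M [] \<longleftrightarrow> xs = []"
  by (auto simp: tuples_def)

lemma tuples_Cons:
  "xs \<in> tuples M (s # ss) \<longleftrightarrow> (\<exists>a ys. xs = a # ys \<and> a \<in> univ M s \<and> ys \<in> tuples M ss)"
  by (auto simp: tuples_def list_all2_Cons2)

lemma tuples_append:
  "xs \<in> tuples M (ss @ tt) \<longleftrightarrow>
    (\<exists>ys zs. xs = ys @ zs \<and> ys \<in> tuples M ss \<and> zs \<in> tuples M tt)"
  by (auto simp: tuples_def list_all2_append2 dest: list_all2_lengthD intro: list_all2_appendI)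

lemma tuples_length: "xs \<in> tuples M ss \<Longrightarrow> length xs = length ss"
  by (auto simp: tuples_def dest: list_all2_lengthD)

lemma tuples_nth: "xs \<in> tuples M ss \<Longrightarrow> i < length ss \<Longrightarrow> xs ! i \<in> univ M (ss ! i)"
  by (auto simp: tuples_def dest: list_all2_nthD2)

lemma term_fun_in_univ:
  assumes "closed_struct M" "term_fun M ss s f" "xs \<in> tuples M ss"
  shows "f xs \<in> univ M s"
  using assms(2,3)
proof (induction rule: term_fun.induct)
  case (app f gs)
  then have "map (\<lambda>g. g xs) gs \<in> tuples M (fargs M f)"
    by (auto simp: tuples_def list_all2_conv_all_nth)
  with app assms(1) show ?case by (auto simp: closed_struct_def)
qed (auto intro: tuples_nth)

text \<open>
  Maps between products of sorts with terms as components: the substitutions along which definable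
  predicates are pulled back.
\<close>
definition term_tuple ::
  "('s, 'f, 'r, 'u) mstruct \<Rightarrow> 's list \<Rightarrow> 's list \<Rightarrow> ('u list \<Rightarrow> 'u list) \<Rightarrow> bool" where
  "term_tuple M ss tt h \<longleftrightarrow> (\<exists>gs. list_all2 (term_fun M ss) tt gs \<and>
     (\<forall>xs \<in> tuples M ss. h xs = map (\<lambda>g. g xs) gs))"

lemma term_tuple_in_tuples:
  assumes "closed_struct M" "term_tuple M ss tt h" "xs \<in> tuples M ss"
  shows "h xs \<in> tuples M tt"
proof -
  obtain gs where gs: "list_all2 (term_fun M ss) tt gs" "h xs = map (\<lambda>g. g xs) gs"
    using assms by (auto simp: term_tuple_def)
  show ?thesis
    unfolding gs(2) using gs(1) term_fun_in_univ[OF assms(1) _ assms(3)]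
    by (auto simp: tuples_def list_all2_conv_all_nth)
qed

lemma term_tuple_Nil: "term_tuple M ss [] (\<lambda>_. [])"
  by (auto simp: term_tuple_def)

lemma term_tuple_append:
  "term_tuple M ss tt h \<Longrightarrow> term_tuple M ss uu k \<Longrightarrow>
    term_tuple M ss (tt @ uu) (\<lambda>xs. h xs @ k xs)"
  unfolding term_tuple_def
proof (elim exE conjE)
  fix gs hs
  assume "list_all2 (term_fun M ss) tt gs" "\<forall>xs\<in>tuples M ss. h xs = map (\<lambda>g. g xs) gs"
   "list_all2 (term_fun M ss) uu hs" "\<forall>xs\<in>tuples M ss. k xs = map (\<lambda>g. g xs) hs"
  then show "\<exists>gs. list_all2 (term_fun M ss) (tt @ uu) gs \<and>
          (\<forall>xs\<in>tuples M ss. h xs @ k xs = map (\<lambda>g. g xs) gs)"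
    by (intro exI[of _ "gs @ hs"]) (auto intro: list_all2_appendI)
qed

lemma term_tuple_single: "term_fun M ss t g \<Longrightarrow> term_tuple M ss [t] (\<lambda>xs. [g xs])"
  unfolding term_tuple_def by (rule exI[of _ "[g]"]) simp

lemma term_tuple_Cons:
  "term_fun M ss t g \<Longrightarrow> term_tuple M ss tt h \<Longrightarrow> term_tuple M ss (t # tt) (\<lambda>xs. g xs # h xs)"
  using term_tuple_append[OF term_tuple_single] by fastforce

lemma term_tuple_coords:
  assumes "k + length tt \<le> length ss" "\<And>i. i < length tt \<Longrightarrow> ss ! (k + i) = tt ! i"
  shows "term_tuple M ss tt (\<lambda>xs. take (length tt) (drop k xs))"
  unfolding term_tuple_def
proof (intro exI[of _ "map (\<lambda>i xs. xs ! (k + i)) [0..<length tt]"] conjI ballI)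
  show "list_all2 (term_fun M ss) tt (map (\<lambda>i xs. xs ! (k + i)) [0..<length tt])"
  proof (intro list_all2_all_nthI)
    fix i assume i: "i < length tt"
    have "term_fun M ss (ss ! (k + i)) (\<lambda>xs. xs ! (k + i))"
      using i assms(1) by (intro term_fun.coord) auto
    with i assms(2) show "term_fun M ss (tt ! i) (map (\<lambda>i xs. xs ! (k + i)) [0..<length tt] ! i)"
      by simp
  qed simp
qed (use assms in \<open>auto dest!: tuples_length intro!: nth_equalityI\<close>)

lemma term_fun_comp:
  assumes "closed_struct M" "term_fun M ss s f" "term_tuple M rr ss h"
  shows "term_fun M rr s (\<lambda>xs. f (h xs))"
proof -
  obtain gs where gs: "list_all2 (term_fun M rr) ss gs"
     "\<And>xs. xs \<in> tuples M rr \<Longrightarrow> h xs = map (\<lambda>g. g xs) gs"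
    using assms by (auto simp: term_tuple_def)
  show ?thesis
    using assms(2)
  proof (induction rule: term_fun.induct)
    case (coord i)
    then have "term_fun M rr (ss ! i) (gs ! i)"
      using gs(1) by (simp add: list_all2_nthD)
    then show ?case
      using gs coord by (elim term_fun.cong) (auto simp: list_all2_lengthD[symmetric])
  next
    case (const s c)
    then show ?case by (rule term_fun.const)
  next
    case (app f hs)
    have "list_all2 (term_fun M rr) (fargs M f) (map (\<lambda>g xs. g (h xs)) hs)"
      using app(2) by (auto simp: list_all2_conv_all_nth)
    from term_fun.app[OF app(1) this] show ?case by (simp add: comp_def)
  next
    case (cong s f g)
    from cong(3) show ?case
      by (rule term_fun.cong) (use cong(2) term_tuple_in_tuples[OF assms(1,3)] in auto)
  qed
qed

lemma term_fun_weaken: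
  assumes "closed_struct M" "term_fun M ss s f"
  shows "term_fun M (tt @ ss) s (\<lambda>xs. f (drop (length tt) xs))"
proof -
  have "term_tuple M (tt @ ss) ss (\<lambda>xs. take (length ss) (drop (length tt) xs))"
    by (rule term_tuple_coords) auto
  from term_fun_comp[OF assms this] show ?thesis
    by (rule term_fun.cong) (auto dest!: tuples_length)
qed

lemma term_fun_hd: "term_fun M (s # ss) s hd"
  by (rule term_fun.cong[OF term_fun.coord[of 0 "s # ss" M, simplified]])
     (auto simp: tuples_Cons)

lemma term_tuple_weaken:
  assumes "closed_struct M" "term_tuple M ss uu h"
  shows "term_tuple M (tt @ ss) uu (\<lambda>xs. h (drop (length tt) xs))"
proof -
  obtain gs where gs: "list_all2 (term_fun M ss) uu gs"
     "\<And>xs. xs \<in> tuples M ss \<Longrightarrow> h xs = map (\<lambda>g. g xs) gs"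
    using assms by (auto simp: term_tuple_def)
  show ?thesis
    unfolding term_tuple_def
    by (intro exI[of _ "map (\<lambda>g xs. g (drop (length tt) xs)) gs"] conjI ballI)
       (use gs term_fun_weaken[OF assms(1)] in
         \<open>auto simp: list_all2_conv_all_nth tuples_append tuples_length\<close>)
qed

text \<open>
  Substitution of terms, the step that would require renaming of bound variables for formulas. Under a
  quantifier the substitution is extended by the new first coordinate.
\<close>
lemma def_pred_comp:
  assumes "closed_struct M" "def_pred M ss P" "term_tuple M rr ss h"
  shows "def_pred M rr (\<lambda>xs. P (h xs))"
  using assms(2,3)
proof (induction arbitrary: rr h rule: def_pred.induct)
  case (eq ss s f g)
  show ?case
    by (rule def_pred.eq[OF term_fun_comp[OF assms(1) eq(1,3)] term_fun_comp[OF assms(1) eq(2,3)]])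
next
  case (rel ss r gs)
  have "list_all2 (term_fun M rr) (rargs M r) (map (\<lambda>g xs. g (h xs)) gs)"
    using rel by (auto simp: list_all2_conv_all_nth intro: term_fun_comp[OF assms(1)])
  from def_pred.rel[OF this] show ?case by (simp add: comp_def)
next
  case (neg ss P)
  then show ?case by (intro def_pred.neg)
next
  case (conj ss P Q)
  then show ?case by (intro def_pred.conj)
next
  case (ex s ss P)
  have "term_tuple M (s # rr) (s # ss) (\<lambda>xs. hd xs # h (drop (length [s]) xs))"
    using term_tuple_weaken[OF assms(1) ex(4), of "[s]"]
    by (intro term_tuple_Cons term_fun_hd) simp
  from def_pred.ex[OF ex(1) ex(3)[OF this]] show ?case by simp
next
  case (cong ss P Q)
  from cong(3)[OF cong(4)] show ?case
    by (rule def_pred.cong) (use cong(2) term_tuple_in_tuples[OF assms(1) cong(4)] in auto)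
qed

lemma def_pred_ex_block:
  assumes "set tt \<subseteq> sorts M" "def_pred M (tt @ ss) P"
  shows "def_pred M ss (\<lambda>xs. \<exists>ys \<in> tuples M tt. P (ys @ xs))"
  using assms
proof (induction tt arbitrary: P rule: list.induct)
  case Nil
  then show ?case by (simp add: tuples_Nil)
next
  case (Cons t tt)
  then have "def_pred M (tt @ ss) (\<lambda>xs. \<exists>a \<in> univ M t. P (a # xs))"
    by (intro def_pred.ex) auto
  then have "def_pred M ss (\<lambda>xs. \<exists>ys \<in> tuples M tt. \<exists>a \<in> univ M t. P (a # ys @ xs))"
    using Cons by simp
  then show ?case
    by (rule def_pred.cong) (simp add: Bex_def tuples_Cons, metis append_Cons)
qed

section \<open>Agreement with definability by formulas\<close>

lemma term_fun_val:
  assumes "wf_trm M t" "\<And>s n. (s, n) \<in> fv_trm t \<Longrightarrow> s \<in> sorts M \<Longrightarrow> term_fun M ss s (\<lambda>xs. a xs s n)"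
  shows "term_fun M ss (sort_of M t) (\<lambda>xs. val M (a xs) t)"
  using assms
proof (induction t)
  case (Var s n)
  then show ?case by simp
next
  case (App f ts)
  have "term_fun M ss (sort_of M t) (\<lambda>xs. val M (a xs) t)" if "t \<in> set ts" for t
    using App.IH[OF that] App.prems that by (metis UN_I fv_trm.simps(2) wf_trm.simps(2))
  then have "list_all2 (term_fun M ss) (map (sort_of M) ts) (map (\<lambda>t xs. val M (a xs) t) ts)"
    by (simp add: list.rel_map list_all2_same)
  then have "list_all2 (term_fun M ss) (fargs M f) (map (\<lambda>t xs. val M (a xs) t) ts)"
    using App.prems(1) by (metis wf_trm.simps(2))
  from term_fun.app[OF _ this] App show ?case by (simp add: comp_def)
qed

text \<open>
  Here \<open>a xs\<close> is any environment that depends on \<open>xs\<close> through terms. A formula quantifier overwrites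
  one value of the environment by the new first entry of the tuple, and the result is again of this
  kind; so the induction never needs to know how variables are named.
\<close>
lemma def_pred_sat:
  assumes "wf_form M p" "closed_struct M"
    and "\<And>s n. (s, n) \<in> fv p \<Longrightarrow> s \<in> sorts M \<Longrightarrow> term_fun M ss s (\<lambda>xs. a xs s n)"
  shows "def_pred M ss (\<lambda>xs. sat M (a xs) p)"
  using assms
proof (induction p arbitrary: ss a)
  case (FEq t u)
  then have "term_fun M ss (sort_of M t) (\<lambda>xs. val M (a xs) t)"
    "term_fun M ss (sort_of M t) (\<lambda>xs. val M (a xs) u)"
    using term_fun_val[of M t ss a] term_fun_val[of M u ss a] by simp_all
  from def_pred.eq[OF this] show ?case by simp
next
  case (FRel r ts)
  have "list_all2 (term_fun M ss) (map (sort_of M) ts) (map (\<lambda>t xs. val M (a xs) t) ts)"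
    unfolding list.rel_map list_all2_same
    using FRel by (metis UN_I fv.simps(2) term_fun_val wf_form.simps(2))
  then have "list_all2 (term_fun M ss) (rargs M r) (map (\<lambda>t xs. val M (a xs) t) ts)"
    using FRel by simp
  from def_pred.rel[OF this] show ?case by (simp add: comp_def)
next
  case (FNot p)
  then show ?case by (auto intro: def_pred.neg)
next
  case (FAnd p q)
  then show ?case by (auto intro!: def_pred.conj)
next
  case (FEx s n p)
  have "def_pred M (s # ss) (\<lambda>ys.
    sat M ((a (drop (length [s]) ys))(s := (a (drop (length [s]) ys) s)(n := hd ys))) p)"
  proof (rule FEx.IH)
    fix s' n' assume *: "(s', n') \<in> fv p" "s' \<in> sorts M"
    show "term_fun M (s # ss) s' (\<lambda>xs.
      ((a (drop (length [s]) xs))(s := (a (drop (length [s]) xs) s)(n := hd xs))) s' n')"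
    proof (cases "s' = s \<and> n' = n")
      case True
      then show ?thesis using term_fun_hd by simp
    next
      case False
      then have "term_fun M ss s' (\<lambda>xs. a xs s' n')"
        using * FEx.prems by auto
      from term_fun_weaken[OF FEx.prems(2) this, of "[s]", unfolded append_Cons append_Nil]
      show ?thesis
        by (rule term_fun.cong) (use False in auto)
    qed
  qed (use FEx in auto)
  from def_pred.ex[OF _ this] FEx show ?case by simp
qed

lemma definable_def_pred:
  assumes "closed_struct M" "definable M ss X"
  shows "def_pred M ss (\<lambda>xs. xs \<in> X)"
proof -
  obtain p e where p: "set ss \<subseteq> sorts M" "wf_form M p"
    "\<forall>(s, n) \<in> fv p - tuple_vars ss. e s n \<in> univ M s"
    "X = {xs \<in> tuples M ss. sat M (assign e ss xs) p}"
    using assms(2) by (auto simp: definable_def)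
  have "def_pred M ss (\<lambda>xs. sat M (assign e ss xs) p)"
  proof (rule def_pred_sat[OF p(2) assms(1)])
    fix s n assume *: "(s, n) \<in> fv p" "s \<in> sorts M"
    show "term_fun M ss s (\<lambda>xs. assign e ss xs s n)"
    proof (cases "(s, n) \<in> tuple_vars ss")
      case True
      then show ?thesis using term_fun.coord[of n ss M]
        by (auto simp: assign_def tuple_vars_def)
    next
      case False
      then have "e s n \<in> univ M s" "\<not> (n < length ss \<and> ss ! n = s)"
        using p(3) * by (auto simp: tuple_vars_def)
      with * show ?thesis
        by (auto simp: assign_def intro: term_fun.const)
    qed
  qed
  then show ?thesis
    by (rule def_pred.cong) (use p in auto)
qed

text \<open>
  For the converse, the entries of the tuple are named by a list \<open>ns\<close> of indices and the finitely many
  parameters in \<open>C\<close> by a function \<open>\<nu>\<close>. Both namings stay universally quantified in \<open>term_named\<close> and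
  \<open>pred_named\<close>: this makes room for the fresh name of a bound variable, and lets the parameters of two
  predicates be merged by taking the union of the two sets.
\<close>
definition names :: "'s list \<Rightarrow> nat list \<Rightarrow> ('s \<times> 'u) set \<Rightarrow> ('s \<times> 'u \<Rightarrow> nat) \<Rightarrow> ('s \<times> nat) set" where
  "names ss ns C \<nu> = {(ss ! i, ns ! i) |i. i < length ss} \<union> (\<lambda>(s, c). (s, \<nu> (s, c))) ` C"

definition fits :: "'s list \<Rightarrow> nat list \<Rightarrow> ('s \<times> 'u) set \<Rightarrow> ('s \<times> 'u \<Rightarrow> nat) \<Rightarrow> 'u list \<Rightarrow>
   ('s \<Rightarrow> nat \<Rightarrow> 'u) \<Rightarrow> bool" where
  "fits ss ns C \<nu> xs e \<longleftrightarrow> (\<forall>i < length ss. e (ss ! i) (ns ! i) = xs ! i) \<and>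
     (\<forall>(s, c) \<in> C. e s (\<nu> (s, c)) = c)"

definition params :: "('s, 'f, 'r, 'u) mstruct \<Rightarrow> ('s \<times> 'u) set \<Rightarrow> bool" where
  "params M C \<longleftrightarrow> finite C \<and> (\<forall>(s, c) \<in> C. c \<in> univ M s)"

lemma params_Un: "params M (C \<union> D) \<longleftrightarrow> params M C \<and> params M D"
  by (auto simp: params_def)

lemma fits_mono: "fits ss ns C \<nu> xs e \<Longrightarrow> D \<subseteq> C \<Longrightarrow> fits ss ns D \<nu> xs e"
  by (auto simp: fits_def)

lemma names_mono: "D \<subseteq> C \<Longrightarrow> names ss ns D \<nu> \<subseteq> names ss ns C \<nu>"
  by (auto simp: names_def)

definition denotes_term where
  "denotes_term M ss ns C \<nu> f t \<longleftrightarrow> wf_trm M t \<and> fv_trm t \<subseteq> names ss ns C \<nu> \<and>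
     (\<forall>xs \<in> tuples M ss. \<forall>e. fits ss ns C \<nu> xs e \<longrightarrow> val M e t = f xs)"

definition denotes_form where
  "denotes_form M ss ns C \<nu> P p \<longleftrightarrow> wf_form M p \<and> fv p \<subseteq> names ss ns C \<nu> \<and>
     (\<forall>xs \<in> tuples M ss. \<forall>e. fits ss ns C \<nu> xs e \<longrightarrow> sat M e p = P xs)"

definition term_named where
  "term_named M ss s f C \<longleftrightarrow> (\<forall>ns \<nu>. length ns = length ss \<longrightarrow>
     (\<exists>t. sort_of M t = s \<and> denotes_term M ss ns C \<nu> f t))"

definition pred_named where
  "pred_named M ss P C \<longleftrightarrow> (\<forall>ns \<nu>. length ns = length ss \<longrightarrow>
     (\<exists>p. denotes_form M ss ns C \<nu> P p))"

lemma denotes_term_mono: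
  "denotes_term M ss ns C \<nu> f t \<Longrightarrow> C \<subseteq> D \<Longrightarrow> denotes_term M ss ns D \<nu> f t"
  unfolding denotes_term_def by (meson fits_mono names_mono order_trans)

lemma denotes_form_mono:
  "denotes_form M ss ns C \<nu> P p \<Longrightarrow> C \<subseteq> D \<Longrightarrow> denotes_form M ss ns D \<nu> P p"
  unfolding denotes_form_def by (meson fits_mono names_mono order_trans)

lemma term_named_mono: "term_named M ss s f C \<Longrightarrow> C \<subseteq> D \<Longrightarrow> term_named M ss s f D"
  unfolding term_named_def using denotes_term_mono by metis

lemma pred_named_mono: "pred_named M ss P C \<Longrightarrow> C \<subseteq> D \<Longrightarrow> pred_named M ss P D"
  unfolding pred_named_def using denotes_form_mono by metis

lemma term_named_list:
  assumes "list_all2 (\<lambda>s g. \<exists>C. params M C \<and> term_named M ss s g C) tt gs"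
  shows "\<exists>C. params M C \<and> list_all2 (\<lambda>s g. term_named M ss s g C) tt gs"
  using assms
proof (induction rule: list_all2_induct)
  case Nil
  then show ?case by (auto simp: params_def)
next
  case (Cons t tt g gs)
  then obtain C D where C: "params M C" "term_named M ss t g C"
    and D: "params M D" "list_all2 (\<lambda>s g. term_named M ss s g D) tt gs" by blast
  have "list_all2 (\<lambda>s g. term_named M ss s g (C \<union> D)) tt gs"
    using D(2) by (rule list_all2_mono) (auto elim: term_named_mono)
  moreover have "term_named M ss t g (C \<union> D)" using C(2) by (auto elim: term_named_mono)
  ultimately show ?case using C(1) D(1) by (intro exI[of _ "C \<union> D"]) (auto simp: params_Un)
qed

lemma term_named_terms:
  assumes "list_all2 (\<lambda>s g. term_named M ss s g C) tt gs" "length ns = length ss"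
  shows "\<exists>ts. map (sort_of M) ts = tt \<and> list_all2 (denotes_term M ss ns C \<nu>) gs ts"
  using assms(1)
proof (induction rule: list_all2_induct)
  case (Cons s tt g gs)
  obtain ts where "map (sort_of M) ts = tt" "list_all2 (denotes_term M ss ns C \<nu>) gs ts"
    using Cons(3) by (elim exE conjE)
  moreover obtain t where "sort_of M t = s" "denotes_term M ss ns C \<nu> g t"
    using Cons(1) assms(2) unfolding term_named_def by blast
  ultimately show ?case by (intro exI[of _ "t # ts"]) simp
qed simp

lemma denotes_terms:
  assumes "list_all2 (denotes_term M ss ns C \<nu>) gs ts"
  shows "\<forall>t \<in> set ts. wf_trm M t" "(\<Union>t \<in> set ts. fv_trm t) \<subseteq> names ss ns C \<nu>"
    "xs \<in> tuples M ss \<Longrightarrow> fits ss ns C \<nu> xs e \<Longrightarrow> map (val M e) ts = map (\<lambda>g. g xs) gs"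
  using assms by (induction rule: list_all2_induct) (simp_all add: denotes_term_def)

lemma term_fun_named:
  assumes "term_fun M ss s f" "set ss \<subseteq> sorts M"
  shows "\<exists>C. params M C \<and> term_named M ss s f C"
  using assms
proof (induction rule: term_fun.induct)
  case (coord i)
  then have "denotes_term M ss ns {} \<nu> (\<lambda>xs. xs ! i) (Var (ss ! i) (ns ! i))" for ns \<nu>
    by (auto simp: names_def fits_def denotes_term_def)
  then have "term_named M ss (ss ! i) (\<lambda>xs. xs ! i) {}"
    unfolding term_named_def by (metis sort_of.simps(1))
  then show ?case by (auto simp: params_def intro!: exI[of _ "{}"])
next
  case (const s c)
  then have "denotes_term M ss ns {(s, c)} \<nu> (\<lambda>xs. c) (Var s (\<nu> (s, c)))" for ns \<nu>
    by (auto simp: names_def fits_def denotes_term_def)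
  then have "term_named M ss s (\<lambda>xs. c) {(s, c)}"
    unfolding term_named_def by (metis sort_of.simps(1))
  then show ?case using const by (auto simp: params_def intro!: exI[of _ "{(s, c)}"])
next
  case (app f gs)
  then have "list_all2 (\<lambda>s g. \<exists>C. params M C \<and> term_named M ss s g C) (fargs M f) gs"
    by (auto elim: list_all2_mono)
  then obtain C where C: "params M C" "list_all2 (\<lambda>s g. term_named M ss s g C) (fargs M f) gs"
    using term_named_list by blast
  have "term_named M ss (fres M f) (\<lambda>xs. fint M f (map (\<lambda>g. g xs) gs)) C"
    unfolding term_named_def
  proof (intro allI impI)
    fix ns :: "nat list" and \<nu> assume "length ns = length ss"
    from term_named_terms[OF C(2) this, where \<nu> = \<nu>] obtain ts where
      ts: "map (sort_of M) ts = fargs M f"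
      "list_all2 (denotes_term M ss ns C \<nu>) gs ts" by (elim exE conjE)
    have "denotes_term M ss ns C \<nu> (\<lambda>xs. fint M f (map (\<lambda>g. g xs) gs)) (App f ts)"
      unfolding denotes_term_def
      using ts(1) denotes_terms[OF ts(2)] app(1) by simp
    then show "\<exists>t. sort_of M t = fres M f \<and>
        denotes_term M ss ns C \<nu> (\<lambda>xs. fint M f (map (\<lambda>g. g xs) gs)) t"
      by (intro exI[of _ "App f ts"]) simp
  qed
  with C(1) show ?case by blast
next
  case (cong s f g)
  then obtain C where C: "params M C" "term_named M ss s f C" by blast
  have "denotes_term M ss ns C \<nu> f t \<Longrightarrow> denotes_term M ss ns C \<nu> g t" for ns \<nu> t
    using cong(2) by (simp add: denotes_term_def)
  then have "term_named M ss s g C" using C(2) unfolding term_named_def by metis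
  with C(1) show ?case by blast
qed

lemma def_pred_named:
  assumes "def_pred M ss P" "set ss \<subseteq> sorts M"
  shows "\<exists>C. params M C \<and> pred_named M ss P C"
  using assms
proof (induction rule: def_pred.induct)
  case (eq ss s f g)
  obtain C where C: "params M C" "term_named M ss s f C"
    using term_fun_named[OF eq(1,3)] by (elim exE conjE)
  obtain D where D: "params M D" "term_named M ss s g D"
    using term_fun_named[OF eq(2,3)] by (elim exE conjE)
  have f: "term_named M ss s f (C \<union> D)" and g: "term_named M ss s g (C \<union> D)"
    using C D by (auto elim: term_named_mono)
  have "denotes_form M ss ns (C \<union> D) \<nu> (\<lambda>xs. f xs = g xs) (FEq t u)"
    if "sort_of M t = s" "denotes_term M ss ns (C \<union> D) \<nu> f t"
       "sort_of M u = s" "denotes_term M ss ns (C \<union> D) \<nu> g u" for ns \<nu> t u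
    using that by (simp add: denotes_form_def denotes_term_def)
  then have "pred_named M ss (\<lambda>xs. f xs = g xs) (C \<union> D)"
    using f g unfolding pred_named_def term_named_def by metis
  with C D show ?case by (auto simp: params_Un intro!: exI[of _ "C \<union> D"])
next
  case (rel ss r gs)
  from rel(1) have "list_all2 (\<lambda>s g. \<exists>C. params M C \<and> term_named M ss s g C) (rargs M r) gs"
    by (rule list_all2_mono) (rule term_fun_named[OF _ rel(2)])
  then obtain C where C: "params M C" "list_all2 (\<lambda>s g. term_named M ss s g C) (rargs M r) gs"
    using term_named_list by blast
  have "pred_named M ss (\<lambda>xs. rint M r (map (\<lambda>g. g xs) gs)) C"
    unfolding pred_named_def
  proof (intro allI impI)
    fix ns :: "nat list" and \<nu> assume "length ns = length ss"
    from term_named_terms[OF C(2) this, where \<nu> = \<nu>] obtain ts where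
      ts: "map (sort_of M) ts = rargs M r"
      "list_all2 (denotes_term M ss ns C \<nu>) gs ts" by (elim exE conjE)
    have "denotes_form M ss ns C \<nu> (\<lambda>xs. rint M r (map (\<lambda>g. g xs) gs)) (FRel r ts)"
      unfolding denotes_form_def
      using ts(1) denotes_terms[OF ts(2)] by simp
    then show "\<exists>p. denotes_form M ss ns C \<nu> (\<lambda>xs. rint M r (map (\<lambda>g. g xs) gs)) p" ..
  qed
  with C(1) show ?case by blast
next
  case (neg ss P)
  then obtain C where C: "params M C" "pred_named M ss P C" by blast
  have "denotes_form M ss ns C \<nu> P p \<Longrightarrow> denotes_form M ss ns C \<nu> (\<lambda>xs. \<not> P xs) (FNot p)" for ns \<nu> p
    by (simp add: denotes_form_def)
  then have "pred_named M ss (\<lambda>xs. \<not> P xs) C" using C(2) unfolding pred_named_def by metis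
  with C(1) show ?case by blast
next
  case (conj ss P Q)
  then obtain C D where C: "params M C" "pred_named M ss P C"
     and D: "params M D" "pred_named M ss Q D" by blast
  have P: "pred_named M ss P (C \<union> D)" and Q: "pred_named M ss Q (C \<union> D)"
    using C D by (auto elim: pred_named_mono)
  have "denotes_form M ss ns (C \<union> D) \<nu> (\<lambda>xs. P xs \<and> Q xs) (FAnd p q)"
    if "denotes_form M ss ns (C \<union> D) \<nu> P p" "denotes_form M ss ns (C \<union> D) \<nu> Q q" for ns \<nu> p q
    using that by (simp add: denotes_form_def)
  then have "pred_named M ss (\<lambda>xs. P xs \<and> Q xs) (C \<union> D)"
    using P Q unfolding pred_named_def by metis
  with C D show ?case by (auto simp: params_Un intro!: exI[of _ "C \<union> D"])
next
  case (ex s ss P)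
  then obtain C where C: "params M C" "pred_named M (s # ss) P C" by auto
  have "pred_named M ss (\<lambda>xs. \<exists>a \<in> univ M s. P (a # xs)) C"
    unfolding pred_named_def
  proof (intro allI impI)
    fix ns :: "nat list" and \<nu> assume ns: "length ns = length ss"
    have "finite (set ns \<union> \<nu> ` C)" using C(1) by (auto simp: params_def)
    \<comment> \<open>the bound variable must collide neither with an entry nor with a parameter\<close>
    then obtain n where n: "n \<notin> set ns \<union> \<nu> ` C" using ex_new_if_finite infinite_UNIV_nat by blast
    have "length (n # ns) = length (s # ss)" using ns by simp
    then obtain p where p: "denotes_form M (s # ss) (n # ns) C \<nu> P p"
      using C(2) unfolding pred_named_def by metis
    have sub: "names (s # ss) (n # ns) C \<nu> \<subseteq> insert (s, n) (names ss ns C \<nu>)"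
    proof (clarify)
      fix s' m assume "(s', m) \<in> names (s # ss) (n # ns) C \<nu>" "(s', m) \<notin> names ss ns C \<nu>"
      then obtain i where "i < Suc (length ss)" "s' = (s # ss) ! i" "m = (n # ns) ! i"
        "(s', m) \<notin> names ss ns C \<nu>"
        by (auto simp: names_def)
      then show "s' = s \<and> m = n" by (cases i) (auto simp: names_def)
    qed
    have "fits (s # ss) (n # ns) C \<nu> (a # xs) (e(s := (e s)(n := a)))"
      if "fits ss ns C \<nu> xs e" for xs e a
      using that n ns unfolding fits_def
      by (auto simp: nth_Cons split: nat.splits)
    then have "sat M (e(s := (e s)(n := a))) p = P (a # xs)"
      if "fits ss ns C \<nu> xs e" "xs \<in> tuples M ss" "a \<in> univ M s" for xs e a
      using p that by (simp add: denotes_form_def tuples_Cons)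
    then have "denotes_form M ss ns C \<nu> (\<lambda>xs. \<exists>a \<in> univ M s. P (a # xs)) (FEx s n p)"
      using p sub ex(1) unfolding denotes_form_def by auto
    then show "\<exists>p. denotes_form M ss ns C \<nu> (\<lambda>xs. \<exists>a \<in> univ M s. P (a # xs)) p" ..
  qed
  with C(1) show ?case by blast
next
  case (cong ss P Q)
  then obtain C where C: "params M C" "pred_named M ss P C" by blast
  have "denotes_form M ss ns C \<nu> P p \<Longrightarrow> denotes_form M ss ns C \<nu> Q p" for ns \<nu> p
    using cong(2) by (simp add: denotes_form_def)
  then have "pred_named M ss Q C" using C(2) unfolding pred_named_def by metis
  with C(1) show ?case by blast
qed

lemma def_pred_definable:
  assumes "set ss \<subseteq> sorts M" "X \<subseteq> tuples M ss" "def_pred M ss (\<lambda>xs. xs \<in> X)"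
  shows "definable M ss X"
proof -
  obtain C where C: "params M C" "pred_named M ss (\<lambda>xs. xs \<in> X) C"
    using def_pred_named assms by blast
  have fin: "finite C" using C(1) by (simp add: params_def)
  then obtain \<mu> :: "'a \<times> 'd \<Rightarrow> nat" where \<mu>: "inj_on \<mu> C"
    using finite_imp_inj_to_nat_seg by metis
  \<comment> \<open>the parameters are named above all coordinates\<close>
  define \<nu> where "\<nu> = (\<lambda>c. length ss + \<mu> c)"
  define e where "e = (\<lambda>s n. SOME c. (s, c) \<in> C \<and> \<nu> (s, c) = n)"
  have e: "e s (\<nu> (s, c)) = c" if "(s, c) \<in> C" for s c
    unfolding e_def by (rule some_equality) (use that \<mu> in \<open>auto simp: \<nu>_def inj_on_def\<close>)
  obtain p where p: "denotes_form M ss [0..<length ss] C \<nu> (\<lambda>xs. xs \<in> X) p"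
    using C(2) unfolding pred_named_def by (metis length_upt diff_zero)
  have "fits ss [0..<length ss] C \<nu> xs (assign e ss xs)" for xs
    using e by (auto simp: fits_def assign_def \<nu>_def)
  then have X: "X = {xs \<in> tuples M ss. sat M (assign e ss xs) p}"
    using p assms(2) by (auto simp: denotes_form_def)
  have "e s n \<in> univ M s" if sn: "(s, n) \<in> fv p - tuple_vars ss" for s n
  proof -
    obtain c where "(s, c) \<in> C" "n = \<nu> (s, c)"
      using sn p by (fastforce simp: names_def tuple_vars_def denotes_form_def)
    with e C(1) show ?thesis by (auto simp: params_def)
  qed
  then show ?thesis
    unfolding definable_def using assms(1) p X by (auto simp: denotes_form_def)
qed

section \<open>Definability in the expansion by imaginaries\<close>

text \<open>
  An element of a sort of the expansion is represented by a tuple of elements of old sorts: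
  itself, or a member of the equivalence class.
\<close>
fun rep_sorts :: "('s, 'f, 'r) eqsort \<Rightarrow> 's list" where
  "rep_sorts (Home s) = [s]"
| "rep_sorts (Quot ss p) = ss"

fun decode_elem ::
  "('s, 'f, 'r, 'u) mstruct \<Rightarrow> ('s, 'f, 'r) eqsort \<Rightarrow> 'u list \<Rightarrow> 'u eqelem" where
  "decode_elem M (Home s) us = Real (hd us)"
| "decode_elem M (Quot ss p) us = Class (form_rel M ss p `` {us})"

fun decode ::
  "('s, 'f, 'r, 'u) mstruct \<Rightarrow> ('s, 'f, 'r) eqsort list \<Rightarrow> 'u list \<Rightarrow> 'u eqelem list" where
  "decode M [] xs = []"
| "decode M (S # \<Gamma>) xs = decode_elem M S (take (length (rep_sorts S)) xs) #
     decode M \<Gamma> (drop (length (rep_sorts S)) xs)"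

lemma eq_expansion_sorts:
  "Home s \<in> sorts (eq_expansion M) \<longleftrightarrow> s \<in> sorts M"
  "Quot ss p \<in> sorts (eq_expansion M) \<longleftrightarrow> equiv_form M ss p"
  by (auto simp: eq_expansion_def)

lemma eq_expansion_symbols:
  "fargs (eq_expansion M) (HomeFun g) = map Home (fargs M g)"
  "fargs (eq_expansion M) (Proj ss p) = map Home ss"
  "fres (eq_expansion M) (HomeFun g) = Home (fres M g)"
  "fres (eq_expansion M) (Proj ss p) = Quot ss p"
  "rargs (eq_expansion M) r = map Home (rargs M r)"
  "fint (eq_expansion M) (HomeFun g) xs = Real (fint M g (map the_real xs))"
  "fint (eq_expansion M) (Proj ss p) xs = Class (form_rel M ss p `` {map the_real xs})"
  "rint (eq_expansion M) r xs = rint M r (map the_real xs)"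
  by (simp_all add: eq_expansion_def)

lemma univ_eq_expansion_Home: "univ (eq_expansion M) (Home s) = Real ` univ M s"
  by (simp add: eq_expansion_def)

lemma univ_eq_expansion: "univ (eq_expansion M) S = decode_elem M S ` tuples M (rep_sorts S)"
proof (cases S)
  case (Home s)
  then show ?thesis by (force simp: eq_expansion_def tuples_Cons tuples_Nil)
next
  case (Quot ss p)
  then show ?thesis by (auto simp: eq_expansion_def quotient_def)
qed

lemma rep_sorts_in_sorts: "S \<in> sorts (eq_expansion M) \<Longrightarrow> set (rep_sorts S) \<subseteq> sorts M"
  by (cases S) (auto simp: eq_expansion_sorts equiv_form_def)

lemma term_tuple_const:
  assumes "set tt \<subseteq> sorts M" "ys \<in> tuples M tt"
  shows "term_tuple M ss tt (\<lambda>_. ys)"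
  using assms
proof (induction tt arbitrary: ys)
  case Nil
  then show ?case by (simp add: tuples_Nil term_tuple_Nil)
next
  case (Cons t tt)
  then show ?case by (auto simp: tuples_Cons intro!: term_tuple_Cons term_fun.const)
qed

lemma tuples_map_Home:
  "xs \<in> tuples (eq_expansion M) (map Home ss) \<longleftrightarrow> (\<exists>us \<in> tuples M ss. xs = map Real us)"
proof
  show "\<exists>us \<in> tuples M ss. xs = map Real us" if "xs \<in> tuples (eq_expansion M) (map Home ss)"
  proof
    have *: "length xs = length ss" "\<And>i. i < length ss \<Longrightarrow> xs ! i \<in> Real ` univ M (ss ! i)"
      using that by (auto simp: tuples_def list_all2_conv_all_nth univ_eq_expansion_Home)
    then show "map the_real xs \<in> tuples M ss"
      by (force simp: tuples_def list_all2_conv_all_nth)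
    show "xs = map Real (map the_real xs)"
      using * by (intro nth_equalityI) force+
  qed
  show "xs \<in> tuples (eq_expansion M) (map Home ss)" if "\<exists>us \<in> tuples M ss. xs = map Real us"
    using that by (auto simp: tuples_def list_all2_conv_all_nth univ_eq_expansion_Home)
qed

lemma closed_struct_eq_expansion:
  assumes "closed_struct M"
  shows "closed_struct (eq_expansion M)"
  unfolding closed_struct_def
proof (intro allI ballI impI)
  fix f xs assume f: "fres (eq_expansion M) f \<in> sorts (eq_expansion M)"
    and xs: "xs \<in> tuples (eq_expansion M) (fargs (eq_expansion M) f)"
  show "fint (eq_expansion M) f xs \<in> univ (eq_expansion M) (fres (eq_expansion M) f)"
  proof (cases f)
    case (HomeFun g)
    then obtain us where "us \<in> tuples M (fargs M g)" "xs = map Real us"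
      using xs by (auto simp: eq_expansion_symbols tuples_map_Home)
    with f HomeFun assms show ?thesis
      by (auto simp: eq_expansion_symbols eq_expansion_sorts univ_eq_expansion_Home
        closed_struct_def comp_def)
  next
    case (Proj ss p)
    then obtain us where "us \<in> tuples M ss" "xs = map Real us"
      using xs by (auto simp: eq_expansion_symbols tuples_map_Home)
    with Proj show ?thesis
      by (auto simp: eq_expansion_symbols univ_eq_expansion comp_def)
  qed
qed

lemma term_fun_sort: "term_fun M ss s f \<Longrightarrow> set ss \<subseteq> sorts M \<Longrightarrow> s \<in> sorts M"
  by (induction rule: term_fun.induct) auto

abbreviation all_rep_sorts :: "('s, 'f, 'r) eqsort list \<Rightarrow> 's list" where
  "all_rep_sorts \<Gamma> \<equiv> concat (map rep_sorts \<Gamma>)"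

text \<open>
  The effect on terms of eliminating the variables of quotient sorts: \<open>h\<close> does to representatives what
  \<open>f\<close> does to the elements that they represent.
\<close>
definition lifts ::
  "('s, 'f, 'r, 'u) mstruct \<Rightarrow> ('s, 'f, 'r) eqsort list \<Rightarrow> ('s, 'f, 'r) eqsort \<Rightarrow>
    ('u eqelem list \<Rightarrow> 'u eqelem) \<Rightarrow> bool" where
  "lifts M \<Gamma> S f \<longleftrightarrow> (\<exists>h. term_tuple M (all_rep_sorts \<Gamma>) (rep_sorts S) h \<and>
     (\<forall>xs \<in> tuples M (all_rep_sorts \<Gamma>). f (decode M \<Gamma> xs) = decode_elem M S (h xs)))"

lemma decode_in_tuples:
  "xs \<in> tuples M (all_rep_sorts \<Gamma>) \<Longrightarrow> decode M \<Gamma> xs \<in> tuples (eq_expansion M) \<Gamma>"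
  by (induction \<Gamma> arbitrary: xs)
     (auto simp: tuples_Nil tuples_Cons tuples_append tuples_length univ_eq_expansion)

lemma lifts_coord:
  assumes "closed_struct M" "i < length \<Gamma>"
  shows "lifts M \<Gamma> (\<Gamma> ! i) (\<lambda>xs. xs ! i)"
  using assms(2)
proof (induction \<Gamma> arbitrary: i)
  case (Cons S \<Gamma>)
  show ?case
  proof (cases i)
    case 0
    have "term_tuple M (all_rep_sorts (S # \<Gamma>)) (rep_sorts S)
      (\<lambda>xs. take (length (rep_sorts S)) (drop 0 xs))"
      by (rule term_tuple_coords) (auto simp: nth_append)
    with 0 show ?thesis by (auto simp: lifts_def)
  next
    case (Suc j)
    then obtain h where h: "term_tuple M (all_rep_sorts \<Gamma>) (rep_sorts (\<Gamma> ! j)) h"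
      "\<forall>xs \<in> tuples M (all_rep_sorts \<Gamma>). decode M \<Gamma> xs ! j = decode_elem M (\<Gamma> ! j) (h xs)"
      using Cons by (fastforce simp: lifts_def)
    from term_tuple_weaken[OF assms(1) h(1), of "rep_sorts S"] h(2) Suc show ?thesis
      unfolding lifts_def
      by (intro exI[of _ "\<lambda>xs. h (drop (length (rep_sorts S)) xs)"])
         (auto simp: tuples_append tuples_length)
  qed
qed simp

lemma lifts_home_args:
  assumes "list_all2 (lifts M \<Gamma>) (map Home ss) gs"
  shows "term_tuple M (all_rep_sorts \<Gamma>) ss (\<lambda>xs. map (\<lambda>g. the_real (g (decode M \<Gamma> xs))) gs)"
  using assms
proof (induction ss arbitrary: gs)
  case Nil
  then show ?case by (simp add: term_tuple_Nil)
next
  case (Cons s ss)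
  then obtain g gs' where gs: "gs = g # gs'" "lifts M \<Gamma> (Home s) g"
    "list_all2 (lifts M \<Gamma>) (map Home ss) gs'" by (auto simp: list_all2_Cons1)
  from gs(2) obtain h where h: "term_tuple M (all_rep_sorts \<Gamma>) [s] h"
    "\<forall>xs \<in> tuples M (all_rep_sorts \<Gamma>). g (decode M \<Gamma> xs) = Real (hd (h xs))"
    by (auto simp: lifts_def)
  then obtain k where k: "term_fun M (all_rep_sorts \<Gamma>) s k"
    "\<forall>xs \<in> tuples M (all_rep_sorts \<Gamma>). h xs = [k xs]"
    by (auto simp: term_tuple_def list_all2_Cons1)
  have "term_fun M (all_rep_sorts \<Gamma>) s (\<lambda>xs. the_real (g (decode M \<Gamma> xs)))"
    using k(1) by (rule term_fun.cong) (use k h in simp)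
  from term_tuple_Cons[OF this Cons.IH[OF gs(3)]] gs(1) show ?case by simp
qed

lemma term_fun_lifts:
  assumes "closed_struct M" "set \<Gamma> \<subseteq> sorts (eq_expansion M)" "term_fun (eq_expansion M) \<Gamma> S f"
  shows "lifts M \<Gamma> S f"
  using assms(3)
proof (induction rule: term_fun.induct)
  case (coord i)
  then show ?case by (rule lifts_coord[OF assms(1)])
next
  case (const S c)
  then obtain ys where "ys \<in> tuples M (rep_sorts S)" "c = decode_elem M S ys"
    by (auto simp: univ_eq_expansion)
  with term_tuple_const[OF rep_sorts_in_sorts[OF const(1)] this(1)] show ?case
    by (auto simp: lifts_def)
next
  case (app f gs)
  have args: "list_all2 (lifts M \<Gamma>) (fargs (eq_expansion M) f) gs"
    using app(2) by (rule list_all2_mono) simp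
  show ?case
  proof (cases f)
    case (HomeFun g)
    then have "list_all2 (lifts M \<Gamma>) (map Home (fargs M g)) gs"
      using args by (simp add: eq_expansion_symbols)
    from lifts_home_args[OF this] obtain ks where
      ks: "list_all2 (term_fun M (all_rep_sorts \<Gamma>)) (fargs M g) ks"
      "\<And>xs. xs \<in> tuples M (all_rep_sorts \<Gamma>) \<Longrightarrow>
         map (\<lambda>g. the_real (g (decode M \<Gamma> xs))) gs = map (\<lambda>g. g xs) ks"
      by (auto simp: term_tuple_def)
    have "fres M g \<in> sorts M" using app(1) HomeFun by (simp add: eq_expansion_symbols eq_expansion_sorts)
    from term_tuple_single[OF term_fun.app[OF this ks(1)]] HomeFun ks(2) show ?thesis
      unfolding lifts_def
      by (intro exI[of _ "\<lambda>xs. [fint M g (map (\<lambda>g. g xs) ks)]"])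
         (simp add: eq_expansion_symbols comp_def)
  next
    case (Proj ss p)
    then have "list_all2 (lifts M \<Gamma>) (map Home ss) gs"
      using args by (simp add: eq_expansion_symbols)
    from lifts_home_args[OF this] Proj show ?thesis
      unfolding lifts_def
      by (intro exI[of _ "\<lambda>xs. map (\<lambda>g. the_real (g (decode M \<Gamma> xs))) gs"])
         (simp add: eq_expansion_symbols comp_def)
  qed
next
  case (cong S f g)
  then show ?case using decode_in_tuples by (fastforce simp: lifts_def)
qed

text \<open>
  Equality of two elements of a quotient sort is the defining equivalence relation between their
  representatives, which is definable since its formula is part of the name of the sort.
\<close>
lemma def_pred_decode_eq:
  assumes "closed_struct M" "S \<in> sorts (eq_expansion M)"
    and "term_tuple M rr (rep_sorts S) h" "term_tuple M rr (rep_sorts S) k"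
  shows "def_pred M rr (\<lambda>xs. decode_elem M S (h xs) = decode_elem M S (k xs))"
proof (cases S)
  case (Home s)
  then obtain f g where fg: "term_fun M rr s f" "term_fun M rr s g"
    "\<forall>xs \<in> tuples M rr. h xs = [f xs]" "\<forall>xs \<in> tuples M rr. k xs = [g xs]"
    using assms by (auto simp: term_tuple_def list_all2_Cons1)
  from def_pred.eq[OF fg(1,2)] show ?thesis
    by (rule def_pred.cong) (use fg Home in simp)
next
  case (Quot ss p)
  then have p: "set ss \<subseteq> sorts M" "wf_form M p" "fv p \<subseteq> tuple_vars (ss @ ss)"
    "equiv (tuples M ss) (form_rel M ss p)"
    using assms(2) by (auto simp: eq_expansion_sorts equiv_form_def)
  have hk: "term_tuple M rr ss h" "term_tuple M rr ss k" using assms Quot by auto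
  have "def_pred M (ss @ ss) (\<lambda>zs. sat M (assign (\<lambda>_ _. undefined) (ss @ ss) zs) p)"
  proof (rule def_pred_sat[OF p(2) assms(1)])
    fix s n assume "(s, n) \<in> fv p"
    then have "n < length (ss @ ss)" "(ss @ ss) ! n = s" using p(3) by (auto simp: tuple_vars_def)
    with term_fun.coord[of n "ss @ ss" M]
    show "term_fun M (ss @ ss) s (\<lambda>zs. assign (\<lambda>_ _. undefined) (ss @ ss) zs s n)"
      by (simp add: assign_def)
  qed
  from def_pred_comp[OF assms(1) this term_tuple_append[OF hk]] show ?thesis
  proof (rule def_pred.cong)
    fix xs assume "xs \<in> tuples M rr"
    then have "h xs \<in> tuples M ss" "k xs \<in> tuples M ss"
      using term_tuple_in_tuples[OF assms(1)] hk by auto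
    then show "(decode_elem M S (h xs) = decode_elem M S (k xs)) =
      sat M (assign (\<lambda>_ _. undefined) (ss @ ss) (h xs @ k xs)) p"
      using eq_equiv_class_iff[OF p(4)] Quot by (simp add: form_rel_def)
  qed
qed

text \<open>
  A quantifier over a quotient sort becomes a block of quantifiers over representatives, and this is
  sound because every class has a representative and all representatives decode to the same element.
\<close>
lemma def_pred_decode:
  assumes "closed_struct M" "def_pred (eq_expansion M) \<Gamma> P" "set \<Gamma> \<subseteq> sorts (eq_expansion M)"
  shows "def_pred M (all_rep_sorts \<Gamma>) (\<lambda>xs. P (decode M \<Gamma> xs))"
  using assms(2,3)
proof (induction rule: def_pred.induct)
  case (eq \<Gamma> S f g)
  from term_fun_lifts[OF assms(1) eq(3,1)] obtain h where
    h: "term_tuple M (all_rep_sorts \<Gamma>) (rep_sorts S) h"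
    "\<forall>xs \<in> tuples M (all_rep_sorts \<Gamma>). f (decode M \<Gamma> xs) = decode_elem M S (h xs)"
    by (auto simp: lifts_def)
  from term_fun_lifts[OF assms(1) eq(3,2)] obtain k where
    k: "term_tuple M (all_rep_sorts \<Gamma>) (rep_sorts S) k"
    "\<forall>xs \<in> tuples M (all_rep_sorts \<Gamma>). g (decode M \<Gamma> xs) = decode_elem M S (k xs)"
    by (auto simp: lifts_def)
  from def_pred_decode_eq[OF assms(1) term_fun_sort[OF eq(1,3)] h(1) k(1)] show ?case
    by (rule def_pred.cong) (use h k in simp)
next
  case (rel \<Gamma> r gs)
  have "list_all2 (lifts M \<Gamma>) (rargs (eq_expansion M) r) gs"
    using rel(1) by (rule list_all2_mono) (rule term_fun_lifts[OF assms(1) rel(2)])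
  then have "list_all2 (lifts M \<Gamma>) (map Home (rargs M r)) gs"
    by (simp add: eq_expansion_symbols)
  from lifts_home_args[OF this] obtain ks where
    ks: "list_all2 (term_fun M (all_rep_sorts \<Gamma>)) (rargs M r) ks"
    "\<And>xs. xs \<in> tuples M (all_rep_sorts \<Gamma>) \<Longrightarrow>
       map (\<lambda>g. the_real (g (decode M \<Gamma> xs))) gs = map (\<lambda>g. g xs) ks"
    by (auto simp: term_tuple_def)
  from def_pred.rel[OF ks(1)] show ?case
    by (rule def_pred.cong) (simp add: eq_expansion_symbols comp_def ks(2))
next
  case (neg \<Gamma> P)
  then show ?case by (auto intro: def_pred.neg)
next
  case (conj \<Gamma> P Q)
  then show ?case by (auto intro: def_pred.conj)
next
  case (ex S \<Gamma> P)
  then have "def_pred M (rep_sorts S @ all_rep_sorts \<Gamma>) (\<lambda>xs. P (decode M (S # \<Gamma>) xs))"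
    by simp
  from def_pred_ex_block[OF rep_sorts_in_sorts[OF ex(1)] this] show ?case
    by (rule def_pred.cong) (auto simp: univ_eq_expansion tuples_length)
next
  case (cong \<Gamma> P Q)
  show ?case
    using cong(3)[OF cong(4)] by (rule def_pred.cong) (simp add: cong(2) decode_in_tuples)
qed

text \<open>
  On old sorts, decoding is the identity up to the constructor \<open>Real\<close>: the expansion has no new
  definable predicates there.
\<close>
lemma def_pred_home:
  assumes "closed_struct M" "set ss \<subseteq> sorts M" "def_pred (eq_expansion M) (map Home ss) P"
  shows "def_pred M ss (\<lambda>xs. P (map Real xs))"
proof -
  have sorts: "all_rep_sorts (map Home ss) = ss" by (induction ss) auto
  have decode: "decode M (map Home ss) xs = map Real xs" if "length xs = length ss" for xs :: "'d list"
    using that by (induction ss arbitrary: xs) (auto simp: length_Suc_conv)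
  have "set (map Home ss) \<subseteq> sorts (eq_expansion M)" using assms(2) by (auto simp: eq_expansion_sorts)
  from def_pred_decode[OF assms(1,3) this] show ?thesis
    unfolding sorts by (rule def_pred.cong) (simp add: decode tuples_length)
qed

section \<open>Definable predicates of a field with finite sets\<close>

abbreviation SF :: keqsort where
  "SF \<equiv> Home FinSort"

definition kval :: "('a, 'b) keqelem \<Rightarrow> 'a" where
  "kval e = projl (the_real e)"

definition fval :: "('a, 'b) keqelem \<Rightarrow> 'b" where
  "fval e = projr (the_real e)"

lemma kval_kel [simp]: "kval (kel x) = x"
  by (simp add: kval_def)

lemma fval_Real [simp]: "fval (Real (Inr F)) = F"
  by (simp add: fval_def)

lemma sorts_kstruct [simp]: "s \<in> sorts (kstruct mem)"
  by (simp add: kstruct_def)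

lemma sorts_keq [simp]: "Home s \<in> sorts (keq mem)"
  by (simp add: eq_expansion_sorts)

lemma univ_keq:
  "univ (keq mem) SK = range kel"
  "univ (keq mem) SF = range (\<lambda>F. Real (Inr F))"
  by (auto simp: univ_eq_expansion_Home kstruct_def)

lemma closed_struct_kstruct: "closed_struct (kstruct mem)"
  by (auto simp: closed_struct_def kstruct_def split: kfun.splits)

lemma closed_struct_keq: "closed_struct (keq mem)"
  by (rule closed_struct_eq_expansion[OF closed_struct_kstruct])

text \<open>
  Definable predicates on tuples of the expansion are written with variables for field elements and
  internally finite sets. After some quantifier introductions the variable bound \<open>k\<close> steps ago is
  \<open>kval (hd xs)\<close> applied after \<open>k\<close> tails, and the rules below follow this shape, so that a proof of
  definability is an application of introduction rules.
\<close>
definition field_term ::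
  "('a::field \<Rightarrow> 'b \<Rightarrow> bool) \<Rightarrow> keqsort list \<Rightarrow> (('a, 'b) keqelem list \<Rightarrow> 'a) \<Rightarrow> bool" where
  "field_term mem ss f \<longleftrightarrow> term_fun (keq mem) ss SK (\<lambda>xs. kel (f xs))"

definition fin_term ::
  "('a::field \<Rightarrow> 'b \<Rightarrow> bool) \<Rightarrow> keqsort list \<Rightarrow> (('a, 'b) keqelem list \<Rightarrow> 'b) \<Rightarrow> bool" where
  "fin_term mem ss f \<longleftrightarrow> term_fun (keq mem) ss SF (\<lambda>xs. Real (Inr (f xs)))"

lemma field_term_const: "field_term mem ss (\<lambda>_. c)"
  unfolding field_term_def by (rule term_fun.const) (auto simp: univ_keq)

lemma fin_term_const: "fin_term mem ss (\<lambda>_. c)"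
  unfolding fin_term_def by (rule term_fun.const) (auto simp: univ_keq)

lemma keq_symbols:
  "fres (keq mem) (HomeFun g) = SK"
  "fargs (keq mem) (HomeFun KNeg) = [SK]"
  "fargs (keq mem) (HomeFun KAdd) = [SK, SK]"
  "fargs (keq mem) (HomeFun KMult) = [SK, SK]"
  "rargs (keq mem) r = [SK, SF]"
  by (simp_all add: eq_expansion_symbols) (simp_all add: kstruct_def)

lemma keq_interpretation:
  "fint (keq mem) (HomeFun KNeg) [kel x] = kel (- x)"
  "fint (keq mem) (HomeFun KAdd) [kel x, kel y] = kel (x + y)"
  "fint (keq mem) (HomeFun KMult) [kel x, kel y] = kel (x * y)"
  "rint (keq mem) r [kel x, Real (Inr F)] \<longleftrightarrow> mem x F"
  by (simp_all add: eq_expansion_symbols) (simp_all add: kstruct_def)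

lemma field_term_uminus: "field_term mem ss f \<Longrightarrow> field_term mem ss (\<lambda>xs. - f xs)"
  unfolding field_term_def
  using term_fun.app[of "keq mem" "HomeFun KNeg" ss "[\<lambda>xs. kel (f xs)]"]
  by (simp add: keq_symbols keq_interpretation)

lemma field_term_add:
  "field_term mem ss f \<Longrightarrow> field_term mem ss g \<Longrightarrow> field_term mem ss (\<lambda>xs. f xs + g xs)"
  unfolding field_term_def
  using term_fun.app[of "keq mem" "HomeFun KAdd" ss "[\<lambda>xs. kel (f xs), \<lambda>xs. kel (g xs)]"]
  by (simp add: keq_symbols keq_interpretation)

lemma field_term_mult:
  "field_term mem ss f \<Longrightarrow> field_term mem ss g \<Longrightarrow> field_term mem ss (\<lambda>xs. f xs * g xs)"
  unfolding field_term_def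
  using term_fun.app[of "keq mem" "HomeFun KMult" ss "[\<lambda>xs. kel (f xs), \<lambda>xs. kel (g xs)]"]
  by (simp add: keq_symbols keq_interpretation)

lemma field_term_diff:
  "field_term mem ss f \<Longrightarrow> field_term mem ss g \<Longrightarrow> field_term mem ss (\<lambda>xs. f xs - g xs)"
  unfolding diff_conv_add_uminus by (intro field_term_add field_term_uminus)

lemma field_term_hd: "field_term mem (SK # ss) (\<lambda>xs. kval (hd xs))"
  unfolding field_term_def
  by (rule term_fun.cong[OF term_fun_hd]) (auto simp: tuples_Cons univ_keq)

lemma fin_term_hd: "fin_term mem (SF # ss) (\<lambda>xs. fval (hd xs))"
  unfolding fin_term_def
  by (rule term_fun.cong[OF term_fun_hd]) (auto simp: tuples_Cons univ_keq)

lemma drop_tl: "drop (length [s]) xs = tl xs"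
  by (simp add: drop_Suc)

lemma field_term_drop:
  "field_term mem ss f \<Longrightarrow> field_term mem (tt @ ss) (\<lambda>xs. f (drop (length tt) xs))"
  unfolding field_term_def by (rule term_fun_weaken[OF closed_struct_keq])

lemma field_term_tl: "field_term mem ss f \<Longrightarrow> field_term mem (s # ss) (\<lambda>xs. f (tl xs))"
  using field_term_drop[of mem ss f "[s]"] by (simp only: drop_tl append_Cons append_Nil)

lemma fin_term_drop:
  "fin_term mem ss f \<Longrightarrow> fin_term mem (tt @ ss) (\<lambda>xs. f (drop (length tt) xs))"
  unfolding fin_term_def by (rule term_fun_weaken[OF closed_struct_keq])

lemma fin_term_tl: "fin_term mem ss f \<Longrightarrow> fin_term mem (s # ss) (\<lambda>xs. f (tl xs))"
  using fin_term_drop[of mem ss f "[s]"] by (simp only: drop_tl append_Cons append_Nil)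

lemma term_tuple_take: "term_tuple M (tt @ ss) tt (take (length tt))"
  using term_tuple_coords[of 0 tt "tt @ ss" M] by (simp add: nth_append)

lemma term_tuple_drop:
  "term_tuple (keq mem) ss uu h \<Longrightarrow>
    term_tuple (keq mem) (tt @ ss) uu (\<lambda>xs. h (drop (length tt) xs))"
  by (rule term_tuple_weaken[OF closed_struct_keq])

lemma term_tuple_tl:
  "term_tuple (keq mem) ss uu h \<Longrightarrow> term_tuple (keq mem) (s # ss) uu (\<lambda>xs. h (tl xs))"
  using term_tuple_drop[of mem ss uu h "[s]"] by (simp only: drop_tl append_Cons append_Nil)

lemma def_pred_mem:
  "field_term mem ss f \<Longrightarrow> fin_term mem ss g \<Longrightarrow>
    def_pred (keq mem) ss (\<lambda>xs. mem (f xs) (g xs))"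
  unfolding field_term_def fin_term_def
  using def_pred.rel[of "keq mem" ss undefined "[\<lambda>xs. kel (f xs), \<lambda>xs. Real (Inr (g xs))]"]
  by (simp add: keq_symbols keq_interpretation)

lemma def_pred_eq:
  "field_term mem ss f \<Longrightarrow> field_term mem ss g \<Longrightarrow>
    def_pred (keq mem) ss (\<lambda>xs. f xs = g xs)"
  unfolding field_term_def
  using def_pred.eq[of "keq mem" ss SK "\<lambda>xs. kel (f xs)" "\<lambda>xs. kel (g xs)"] by simp

lemma def_pred_disj:
  assumes "def_pred M ss P" "def_pred M ss Q"
  shows "def_pred M ss (\<lambda>xs. P xs \<or> Q xs)"
  using def_pred.neg[OF def_pred.conj[OF def_pred.neg[OF assms(1)] def_pred.neg[OF assms(2)]]]
  by simp

lemma def_pred_imp: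
  assumes "def_pred M ss P" "def_pred M ss Q"
  shows "def_pred M ss (\<lambda>xs. P xs \<longrightarrow> Q xs)"
  by (rule def_pred.cong[OF def_pred_disj[OF def_pred.neg[OF assms(1)] assms(2)]]) blast

lemma def_pred_iff:
  assumes "def_pred M ss P" "def_pred M ss Q"
  shows "def_pred M ss (\<lambda>xs. P xs \<longleftrightarrow> Q xs)"
  by (rule def_pred.cong[OF def_pred.conj[OF def_pred_imp[OF assms] def_pred_imp[OF assms(2,1)]]])
     blast

lemma def_pred_ex:
  assumes "def_pred (keq mem) (SK # ss) (\<lambda>xs. P (tl xs) (kval (hd xs)))"
  shows "def_pred (keq mem) ss (\<lambda>xs. \<exists>x. P xs x)"
  using def_pred.ex[OF _ assms] by (simp add: univ_keq)

lemma def_pred_ex_fin: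
  assumes "def_pred (keq mem) (SF # ss) (\<lambda>xs. P (tl xs) (fval (hd xs)))"
  shows "def_pred (keq mem) ss (\<lambda>xs. \<exists>F. P xs F)"
  using def_pred.ex[OF _ assms] by (simp add: univ_keq)

lemma def_pred_all:
  assumes "def_pred (keq mem) (SK # ss) (\<lambda>xs. P (tl xs) (kval (hd xs)))"
  shows "def_pred (keq mem) ss (\<lambda>xs. \<forall>x. P xs x)"
  using def_pred.neg[OF def_pred_ex[of mem ss "\<lambda>xs x. \<not> P xs x", OF def_pred.neg[OF assms]]]
  by simp

lemma def_pred_ex_tuple:
  assumes "set tt \<subseteq> sorts M"
    and "def_pred M (tt @ ss) (\<lambda>xs. P (drop (length tt) xs) (take (length tt) xs))"
  shows "def_pred M ss (\<lambda>xs. \<exists>S \<in> tuples M tt. P xs S)"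
  using def_pred_ex_block[OF assms] by (rule def_pred.cong) (simp add: tuples_length)

lemma def_pred_nat:
  assumes "field_term mem ss f"
  shows "def_pred (keq mem) ss (\<lambda>xs. f xs \<in> kN mem)"
  unfolding K0_def mem_Collect_eq
  by (intro def_pred_ex_fin def_pred.conj def_pred_all def_pred_imp def_pred_mem def_pred.neg
    def_pred_eq field_term_const field_term_hd fin_term_hd field_term_diff field_term_tl fin_term_tl
    assms)

lemmas term_rules = field_term_const fin_term_const field_term_hd fin_term_hd
  field_term_add field_term_diff field_term_uminus field_term_mult
  field_term_tl fin_term_tl field_term_drop fin_term_drop

lemmas def_pred_rules = def_pred_nat def_pred.conj def_pred_disj def_pred_imp def_pred_iff
  def_pred_ex def_pred_ex_fin def_pred_all def_pred_mem def_pred_eq def_pred.neg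

text \<open>
  Definable predicates that are not given by an explicit formula, in the form in which they can be
  applied to arbitrary terms (\<open>definable1_app\<close>, \<open>definable2_app\<close>).
\<close>
definition definable1 :: "('a::field \<Rightarrow> 'b \<Rightarrow> bool) \<Rightarrow> ('a \<Rightarrow> bool) \<Rightarrow> bool" where
  "definable1 mem P \<longleftrightarrow> def_pred (keq mem) [SK] (\<lambda>xs. P (kval (hd xs)))"

definition definable2 :: "('a::field \<Rightarrow> 'b \<Rightarrow> bool) \<Rightarrow> ('a \<Rightarrow> 'a \<Rightarrow> bool) \<Rightarrow> bool" where
  "definable2 mem P \<longleftrightarrow>
     def_pred (keq mem) [SK, SK] (\<lambda>xs. P (kval (hd xs)) (kval (hd (tl xs))))"

lemma definable1_app:
  assumes "definable1 mem P" "field_term mem ss f"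
  shows "def_pred (keq mem) ss (\<lambda>xs. P (f xs))"
  using def_pred_comp[OF closed_struct_keq assms(1)[unfolded definable1_def]
    term_tuple_single[OF assms(2)[unfolded field_term_def]]] by simp

lemma definable2_app:
  assumes "definable2 mem P" "field_term mem ss f" "field_term mem ss g"
  shows "def_pred (keq mem) ss (\<lambda>xs. P (f xs) (g xs))"
  using def_pred_comp[OF closed_struct_keq assms(1)[unfolded definable2_def]
    term_tuple_Cons[OF assms(2)[unfolded field_term_def]
      term_tuple_single[OF assms(3)[unfolded field_term_def]]]] by simp

section \<open>Internally finite sets\<close>

definition coded :: "('a::field \<Rightarrow> 'b \<Rightarrow> bool) \<Rightarrow> 'a set \<Rightarrow> bool" where
  "coded mem A \<longleftrightarrow> (\<exists>F. \<forall>x. mem x F \<longleftrightarrow> x \<in> A)"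

text \<open>
  The relation inside \<open>A \<times> B\<close> coded by \<open>G\<close> along the slope \<open>t\<close>. Every relation
  obtained from the empty one by finitely many additions of pairs, in the internal sense, has this
  form (\<open>pair_mem_empty\<close>, \<open>pair_mem_insert\<close>).
\<close>
definition pair_mem ::
  "('a::field \<Rightarrow> 'b \<Rightarrow> bool) \<Rightarrow> 'b \<Rightarrow> 'b \<Rightarrow> 'b \<Rightarrow> 'a \<Rightarrow> 'a \<Rightarrow> 'a \<Rightarrow> bool" where
  "pair_mem mem A B G t a b \<longleftrightarrow> mem a A \<and> mem b B \<and> mem (a + t * b) G"

text \<open>
  A condition on neighbouring indices only, hence first-order in \<open>r\<close>; iterated downwards along \<open>N\<close>, it
  forces each value recorded in \<open>r\<close> to be the one that the recursion prescribes.
\<close>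
definition approx :: "('a::field \<Rightarrow> 'a \<Rightarrow> 'a \<Rightarrow> bool) \<Rightarrow> ('a \<Rightarrow> 'a \<Rightarrow> bool) \<Rightarrow> bool" where
  "approx step r \<longleftrightarrow> (\<forall>i z. r i z \<longrightarrow>
     i = 0 \<and> z = 1 \<or> i \<noteq> 0 \<and> (\<exists>w. r (i - 1) w \<and> step (i - 1) w z))"

locale char_zero_field =
  fixes mem :: "'a::field \<Rightarrow> 'b \<Rightarrow> bool"
  assumes finite_power_field: "finite_power_field mem"
    and char_zero: "definable_char_zero mem"
begin

text \<open>
  By \<open>def_pred_home\<close>, the induction principle of the finite power set holds for predicates definable
  in the expansion. It is used in a form that mentions only the extensions of finite sets.
\<close>
lemma coded_empty: "coded mem {}"
  and coded_insert: "coded mem A \<Longrightarrow> coded mem (insert a A)"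
  and fin_induct: "def_pred (keq mem) [SF] (\<lambda>xs. P (fval (hd xs))) \<Longrightarrow>
    (\<And>F. \<forall>x. \<not> mem x F \<Longrightarrow> P F) \<Longrightarrow>
    (\<And>F G a. P F \<Longrightarrow> \<forall>x. mem x G \<longleftrightarrow> mem x F \<or> x = a \<Longrightarrow> P G) \<Longrightarrow> P F"
proof -
  define R :: "(('a + 'b) list \<times> ('a + 'b) list) set" where "R = {([Inl x], [Inr F]) | x F. mem x F}"
  have R: "([Inl x], [Inr F]) \<in> R \<longleftrightarrow> mem x F" for x F by (simp add: R_def)
  have X: "tuples (kstruct mem) [FieldSort] = (\<lambda>x. [Inl x]) ` UNIV"
    and Y: "tuples (kstruct mem) [FinSort] = (\<lambda>F. [Inr F]) ` UNIV"
    by (auto simp: tuples_Cons tuples_Nil kstruct_def)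
  let ?X = "tuples (kstruct mem) [FieldSort]" and ?Y = "tuples (kstruct mem) [FinSort]"
  from finite_power_field[unfolded finite_power_field_def definable_finite_power_set_def,
      folded R_def]
  obtain emp sing un where emp: "emp \<in> ?Y" "\<forall>x \<in> ?X. (x, emp) \<notin> R" and
    sing: "\<forall>a \<in> ?X. sing a \<in> ?Y \<and> (\<forall>x \<in> ?X. (x, sing a) \<in> R \<longleftrightarrow> x = a)" and
    un: "\<forall>B \<in> ?Y. \<forall>C \<in> ?Y. un B C \<in> ?Y \<and>
      (\<forall>x \<in> ?X. (x, un B C) \<in> R \<longleftrightarrow> (x, B) \<in> R \<or> (x, C) \<in> R)" and
    ind: "\<forall>U. definable (kstruct mem) [FinSort] U \<and> U \<subseteq> ?Y \<and> emp \<in> U \<and>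
      (\<forall>B \<in> U. \<forall>x \<in> ?X. un B (sing x) \<in> U) \<longrightarrow> U = ?Y"
    by (elim exE conjE) (rule that)
  obtain E where E: "emp = [Inr E]" "\<forall>x. \<not> mem x E" using emp R X Y by auto
  have "\<forall>a. \<exists>F. sing [Inl a] = [Inr F]" using sing X Y by auto
  then obtain sg where sg: "\<And>a. sing [Inl a] = [Inr (sg a)]" by metis
  then have mem_sg: "mem x (sg a) \<longleftrightarrow> x = a" for x a
    using sing[unfolded X, rule_format, of "[Inl a]"] by (simp add: R)
  have "\<forall>B a. \<exists>F. un [Inr B] (sing [Inl a]) = [Inr F]" using un sg X Y by auto
  then obtain ins where ins: "\<And>B a. un [Inr B] (sing [Inl a]) = [Inr (ins B a)]" by metis
  then have mem_ins: "mem x (ins B a) \<longleftrightarrow> mem x B \<or> x = a" for x B a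
    using un[unfolded X Y, rule_format, of "[Inr B]" "[Inr (sg a)]"]
    by (simp add: R mem_sg ins[unfolded sg])
  show "coded mem {}" using E(2) by (auto simp: coded_def)
  show "coded mem (insert a A)" if "coded mem A"
    using that mem_ins unfolding coded_def by (metis insert_iff)
  show "P F" if P: "def_pred (keq mem) [SF] (\<lambda>xs. P (fval (hd xs)))"
    "\<And>F. \<forall>x. \<not> mem x F \<Longrightarrow> P F"
    "\<And>F G a. P F \<Longrightarrow> \<forall>x. mem x G \<longleftrightarrow> mem x F \<or> x = a \<Longrightarrow> P G"
  proof -
    define U :: "('a + 'b) list set" where "U = {[Inr F] | F. P F}"
    have "def_pred (kstruct mem) [FinSort] (\<lambda>xs. P (fval (hd (map Real xs))))"
      using def_pred_home[OF closed_struct_kstruct, of "[FinSort]"] P(1) by simp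
    then have "def_pred (kstruct mem) [FinSort] (\<lambda>xs. xs \<in> U)"
      by (rule def_pred.cong) (auto simp: Y U_def)
    then have "definable (kstruct mem) [FinSort] U"
      by (intro def_pred_definable) (auto simp: Y U_def)
    moreover have "U \<subseteq> ?Y" "emp \<in> U" using E P(2) by (auto simp: U_def Y)
    moreover have "\<forall>B \<in> U. \<forall>x \<in> ?X. un B (sing x) \<in> U"
    proof (intro ballI)
      fix B x assume "B \<in> U" "x \<in> ?X"
      then obtain F a where F: "B = [Inr F]" "P F" "x = [Inl a]" by (auto simp: U_def X)
      then have "P (ins F a)" using P(3) mem_ins by blast
      with F ins show "un B (sing x) \<in> U" by (auto simp: U_def)
    qed
    ultimately have "U = ?Y" using ind by blast
    then have "[Inr F] \<in> U" by (simp add: Y)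
    then show "P F" by (auto simp: U_def)
  qed
qed

text \<open>
  Replacement for internally finite sets: the union of a definable family of internally finite sets
  over an internally finite index set is internally finite, by induction on the index set. Separation
  and images are special cases.
\<close>
lemma coded_UN:
  assumes "definable2 mem D" "\<And>a. mem a A \<Longrightarrow> coded mem {x. D a x}"
  shows "coded mem {x. \<exists>a. mem a A \<and> D a x}"
proof -
  have "(\<forall>a. mem a A \<longrightarrow> coded mem {x. D a x}) \<longrightarrow> coded mem {x. \<exists>a. mem a A \<and> D a x}"
  proof (rule fin_induct)
    show "def_pred (keq mem) [SF] (\<lambda>xs. (\<forall>a. mem a (fval (hd xs)) \<longrightarrow> coded mem {x. D a x}) \<longrightarrow>
      coded mem {x. \<exists>a. mem a (fval (hd xs)) \<and> D a x})"
      unfolding coded_def mem_Collect_eq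
      by (intro def_pred_rules term_rules definable2_app[OF assms(1)])
  next
    fix F assume "\<forall>x. \<not> mem x F"
    then show "(\<forall>a. mem a F \<longrightarrow> coded mem {x. D a x}) \<longrightarrow>
      coded mem {x. \<exists>a. mem a F \<and> D a x}" by (simp add: coded_empty)
  next
    fix F G a
    assume IH: "(\<forall>a. mem a F \<longrightarrow> coded mem {x. D a x}) \<longrightarrow> coded mem {x. \<exists>a. mem a F \<and> D a x}"
      and G: "\<forall>x. mem x G \<longleftrightarrow> mem x F \<or> x = a"
    have union: "coded mem (B \<union> {x. mem x C})" if B: "coded mem B" for B C
    proof -
      have "coded mem (B \<union> {x. mem x C})"
      proof (rule fin_induct[of "\<lambda>C. coded mem (B \<union> {x. mem x C})"])
        obtain F where F: "x \<in> B \<longleftrightarrow> mem x F" for x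
          using B unfolding coded_def by metis
        show "def_pred (keq mem) [SF] (\<lambda>xs. coded mem (B \<union> {x. mem x (fval (hd xs))}))"
          unfolding coded_def Un_iff mem_Collect_eq F
          by (intro def_pred_rules term_rules)
        show "coded mem (B \<union> {x. mem x F})" if "\<forall>x. \<not> mem x F" for F
          using that B by simp
        show "coded mem (B \<union> {x. mem x G})"
          if "coded mem (B \<union> {x. mem x F})" "\<forall>x. mem x G \<longleftrightarrow> mem x F \<or> x = a" for F G a
        proof -
          have "B \<union> {x. mem x G} = insert a (B \<union> {x. mem x F})" using that(2) by auto
          then show ?thesis using coded_insert[OF that(1)] by simp
        qed
      qed
      then show ?thesis .
    qed
    show "(\<forall>a. mem a G \<longrightarrow> coded mem {x. D a x}) \<longrightarrow> coded mem {x. \<exists>a. mem a G \<and> D a x}"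
    proof
      assume *: "\<forall>a. mem a G \<longrightarrow> coded mem {x. D a x}"
      then have "coded mem {x. D a x}" using G by simp
      then obtain C where C: "\<And>x. mem x C \<longleftrightarrow> D a x" by (auto simp: coded_def)
      have "coded mem {x. \<exists>a. mem a F \<and> D a x}" using IH G * by auto
      from union[OF this, of C] show "coded mem {x. \<exists>a. mem a G \<and> D a x}"
        by (rule back_subst) (use G C in auto)
    qed
  qed
  then show ?thesis using assms(2) by blast
qed

lemma coded_subsingleton:
  assumes "\<And>x y. x \<in> A \<Longrightarrow> y \<in> A \<Longrightarrow> x = y"
  shows "coded mem A"
proof (cases "A = {}")
  case False
  then obtain a where "A = insert a {}" using assms by auto
  then show ?thesis using coded_insert coded_empty by simp
qed (simp add: coded_empty)

lemma coded_image2: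
  assumes "\<And>ss f g h. field_term mem ss f \<Longrightarrow> field_term mem ss g \<Longrightarrow> field_term mem ss h \<Longrightarrow>
      def_pred (keq mem) ss (\<lambda>xs. D (f xs) (g xs) (h xs))"
    and "\<And>a b x y. D a b x \<Longrightarrow> D a b y \<Longrightarrow> x = y"
  shows "coded mem {x. \<exists>a b. mem a A \<and> mem b B \<and> D a b x}"
proof -
  have "coded mem {x. \<exists>b. mem b B \<and> D a b x}" for a
    unfolding ex_simps
  proof (rule coded_UN)
    show "definable2 mem (\<lambda>b x. D a b x)"
      unfolding definable2_def by (intro assms(1) term_rules)
  qed (rule coded_subsingleton, use assms(2) in blast)
  moreover have "definable2 mem (\<lambda>a x. \<exists>b. mem b B \<and> D a b x)"
    unfolding definable2_def by (intro def_pred_rules assms(1) term_rules)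
  ultimately have "coded mem {x. \<exists>a. mem a A \<and> (\<exists>b. mem b B \<and> D a b x)}"
    by (rule coded_UN[rotated])
  then show ?thesis by simp
qed

lemma neg_one_notin_nat: "- 1 \<notin> kN mem"
  using char_zero by (simp add: definable_char_zero_def)

text \<open>
  Otherwise \<open>A\<close> would itself witness that \<open>- 1\<close> is in \<open>N\<close>.
\<close>
lemma no_pred_closed:
  assumes "coded mem A" "0 \<in> A" "\<And>x. x \<in> A \<Longrightarrow> x - 1 \<in> A"
  shows False
proof -
  obtain F where F: "\<And>x. mem x F \<longleftrightarrow> x \<in> A" using assms(1) by (auto simp: coded_def)
  have "- 1 \<in> A" using assms(2) assms(3)[of 0] by simp
  then have "- 1 \<in> kN mem" unfolding K0_def by (intro CollectI exI[of _ F]) (simp add: F assms(3))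
  with neg_one_notin_nat show False ..
qed

lemma ex_not_mem: "\<exists>x. \<not> mem x F"
  using no_pred_closed[of "{x. mem x F}"] by (auto simp: coded_def)

lemma zero_nat: "0 \<in> kN mem"
proof -
  obtain F where "\<forall>x. mem x F \<longleftrightarrow> x = 0"
    using coded_insert[OF coded_empty, of 0] by (auto simp: coded_def)
  then show ?thesis by (auto simp: K0_def intro!: exI[of _ F])
qed

lemma Suc_nat: "n \<in> kN mem \<Longrightarrow> n + 1 \<in> kN mem"
proof -
  assume "n \<in> kN mem"
  then obtain F where F: "mem n F" "\<forall>z. mem z F \<longrightarrow> z \<noteq> 0 \<longrightarrow> mem (z - 1) F"
    by (auto simp: K0_def)
  obtain G where "\<forall>x. mem x G \<longleftrightarrow> x = n + 1 \<or> mem x F"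
    using coded_insert[of "{x. mem x F}" "n + 1"] by (auto simp: coded_def)
  with F show ?thesis unfolding K0_def by (intro CollectI exI[of _ G]) auto
qed

lemma Suc_neq_zero: "n \<in> kN mem \<Longrightarrow> n + 1 \<noteq> 0"
  using neg_one_notin_nat by (metis add_eq_0_iff add.commute)

text \<open>
  Let \<open>F\<close> witness that \<open>n\<close> is in \<open>N\<close>. If \<open>P n\<close> fails, the elements of \<open>F\<close> where \<open>P\<close> fails form a set that
  contains \<open>n\<close>, avoids \<open>0\<close> and is closed under predecessors. Its translate by \<open>- n\<close> contains \<open>0\<close> and is
  closed under predecessors, contradicting \<open>no_pred_closed\<close>.
\<close>
lemma nat_induct:
  assumes "n \<in> kN mem" "definable1 mem P" "P 0" "\<And>m. m \<in> kN mem \<Longrightarrow> P m \<Longrightarrow> P (m + 1)"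
  shows "P n"
proof (rule ccontr)
  assume "\<not> P n"
  obtain F where F: "mem n F" "\<forall>z. mem z F \<longrightarrow> z \<noteq> 0 \<longrightarrow> mem (z - 1) F"
    using assms(1) by (auto simp: K0_def)
  define A where "A = {x. \<exists>a. mem a F \<and> (\<not> P a \<and> x + n = a)}"
  have "coded mem A"
    unfolding A_def
  proof (rule coded_UN)
    show "definable2 mem (\<lambda>a x. \<not> P a \<and> x + n = a)"
      unfolding definable2_def by (intro def_pred_rules definable1_app[OF assms(2)] term_rules)
  qed (rule coded_subsingleton, auto)
  moreover have "0 \<in> A" using F(1) \<open>\<not> P n\<close> by (simp add: A_def)
  moreover have "x - 1 \<in> A" if "x \<in> A" for x
  proof -
    have x: "mem (x + n) F" "\<not> P (x + n)" using that by (auto simp: A_def)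
    then have *: "mem (x + n - 1) F" using F(2) assms(3) by metis
    then have "x + n - 1 \<in> kN mem" using F(2) by (auto simp: K0_def)
    then have "\<not> P (x + n - 1)" using assms(4) x(2) by fastforce
    with * show ?thesis by (simp add: A_def algebra_simps)
  qed
  ultimately show False by (rule no_pred_closed)
qed

section \<open>Internally finite relations\<close>

text \<open>
  If \<open>a + t * b = a' + t * b'\<close> with \<open>b \<noteq> b'\<close>, then \<open>t\<close> is the quotient of a difference of elements of
  \<open>A\<close> by one of elements of \<open>B\<close>. These quotients form an internally finite set, and some \<open>t\<close> avoids it.
\<close>
lemma ex_injective_slope:
  "\<exists>t. \<forall>a a' b b'. mem a A \<longrightarrow> mem a' A \<longrightarrow> mem b B \<longrightarrow> mem b' B \<longrightarrow>
     a + t * b = a' + t * b' \<longrightarrow> a = a' \<and> b = b'"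
proof -
  have "coded mem {x. \<exists>a b. mem a C \<and> mem b C \<and> x = a - b}" for C
    by (rule coded_image2) (intro def_pred_rules term_rules, auto)
  then obtain E where E: "\<And>C x. mem x (E C) \<longleftrightarrow> (\<exists>a b. mem a C \<and> mem b C \<and> x = a - b)"
    unfolding coded_def mem_Collect_eq by metis
  have "coded mem {x. \<exists>a b. mem a (E A) \<and> mem b (E B) \<and> (b \<noteq> 0 \<and> x * b = a)}"
    by (rule coded_image2) (intro def_pred_rules term_rules, auto)
  then obtain Q where Q: "\<And>x. mem x Q \<longleftrightarrow>
      (\<exists>a b. mem a (E A) \<and> mem b (E B) \<and> (b \<noteq> 0 \<and> x * b = a))"
    unfolding coded_def mem_Collect_eq by metis
  obtain t where t: "\<not> mem t Q" using ex_not_mem by blast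
  have "b = b'" if "mem a A" "mem a' A" "mem b B" "mem b' B" "a + t * b = a' + t * b'" for a a' b b'
  proof (rule ccontr)
    assume "b \<noteq> b'"
    moreover have "t * (b' - b) = a - a'" using that(5) by (simp add: algebra_simps)
    moreover have "mem (a - a') (E A)" "mem (b' - b) (E B)" using that E by blast+
    ultimately have "mem t Q" using Q by (metis right_minus_eq)
    with t show False ..
  qed
  then show ?thesis by (intro exI[of _ t]) fastforce
qed

lemma pair_mem_empty: "\<exists>A B G t. \<forall>a b. \<not> pair_mem mem A B G t a b"
proof -
  obtain F where "\<forall>x. \<not> mem x F" using coded_empty by (auto simp: coded_def)
  then have "\<forall>a b. \<not> pair_mem mem F F F 0 a b" by (simp add: pair_mem_def)
  then show ?thesis by blast
qed

text \<open>
  The old slope need not be injective on the enlarged rectangle, so the whole relation is coded anew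
  along a slope that is.
\<close>
lemma pair_mem_insert:
  "\<exists>A' B' G' t'. \<forall>a b. pair_mem mem A' B' G' t' a b \<longleftrightarrow>
     pair_mem mem A B G t a b \<or> a = c \<and> b = d"
proof -
  obtain A' where A': "\<And>x. mem x A' \<longleftrightarrow> x = c \<or> mem x A"
    using coded_insert[of "{x. mem x A}" c] by (auto simp: coded_def)
  obtain B' where B': "\<And>x. mem x B' \<longleftrightarrow> x = d \<or> mem x B"
    using coded_insert[of "{x. mem x B}" d] by (auto simp: coded_def)
  obtain t' where t': "\<And>a a' b b'. mem a A' \<Longrightarrow> mem a' A' \<Longrightarrow> mem b B' \<Longrightarrow> mem b' B' \<Longrightarrow>
     a + t' * b = a' + t' * b' \<Longrightarrow> a = a' \<and> b = b'"
    using ex_injective_slope by metis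
  have "coded mem {x. \<exists>a b. mem a A' \<and> mem b B' \<and>
    (x = a + t' * b \<and> (pair_mem mem A B G t a b \<or> a = c \<and> b = d))}"
    unfolding pair_mem_def by (rule coded_image2) (intro def_pred_rules term_rules, auto)
  then obtain G' where G': "\<And>x. mem x G' \<longleftrightarrow> (\<exists>a b. mem a A' \<and> mem b B' \<and>
    (x = a + t' * b \<and> (pair_mem mem A B G t a b \<or> a = c \<and> b = d)))"
    unfolding coded_def mem_Collect_eq by metis
  have "pair_mem mem A' B' G' t' a b \<longleftrightarrow> pair_mem mem A B G t a b \<or> a = c \<and> b = d" for a b
  proof
    assume *: "pair_mem mem A' B' G' t' a b"
    then obtain a' b' where "mem a' A'" "mem b' B'" "a + t' * b = a' + t' * b'"
      "pair_mem mem A B G t a' b' \<or> a' = c \<and> b' = d" using G' by (auto simp: pair_mem_def)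
    moreover have "mem a A'" "mem b B'" using * by (auto simp: pair_mem_def)
    ultimately show "pair_mem mem A B G t a b \<or> a = c \<and> b = d" using t' by metis
  next
    assume *: "pair_mem mem A B G t a b \<or> a = c \<and> b = d"
    then have "mem a A'" "mem b B'" using A' B' by (auto simp: pair_mem_def)
    with * G' show "pair_mem mem A' B' G' t' a b" by (auto simp: pair_mem_def)
  qed
  then show ?thesis by blast
qed

section \<open>Recursion along N\<close>

lemma kseg_iff: "i \<in> kseg mem n \<longleftrightarrow> i \<in> kN mem \<and> n - i \<in> kN mem \<and> i \<noteq> n"
  by (auto simp: kseg_def kless_def kle_def)

lemma kseg_Suc:
  assumes "j \<in> kN mem" "n - j \<in> kN mem"
  shows "j \<in> kseg mem (n + 1)"
proof -
  have "n + 1 - j \<in> kN mem" using Suc_nat[OF assms(2)] by (simp add: algebra_simps)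
  moreover have "j \<noteq> n + 1" using Suc_neq_zero[OF assms(2)] by auto
  ultimately show ?thesis using assms(1) by (simp add: kseg_iff)
qed

text \<open>
  Here \<open>n - (j + 1) \<in> N\<close> means \<open>j + 1 \<le> n\<close>, and \<open>j \<noteq> n\<close> follows since a successor is not \<open>0\<close>.
\<close>
lemma kseg_if_Suc_le:
  assumes "j \<in> kN mem" "n - (j + 1) \<in> kN mem"
  shows "j \<in> kseg mem n"
proof -
  have eq: "n - (j + 1) + 1 = n - j" by simp
  have "n - j \<in> kN mem" "n - j \<noteq> 0"
    using Suc_nat[OF assms(2)] Suc_neq_zero[OF assms(2)] unfolding eq by auto
  then show ?thesis using assms(1) by (auto simp: kseg_iff)
qed

text \<open>
  A nonzero element of \<open>N\<close> has its predecessor in \<open>N\<close>, with the same witness.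
\<close>
lemma Suc_le_if_kseg:
  assumes "j \<in> kseg mem n"
  shows "n - (j + 1) \<in> kN mem"
proof -
  obtain G where G: "mem (n - j) G" "\<forall>z. mem z G \<longrightarrow> z \<noteq> 0 \<longrightarrow> mem (z - 1) G"
    using assms unfolding kseg_iff K0_def by blast
  then have "mem (n - j - 1) G" using assms by (metis kseg_iff right_minus_eq)
  then have "mem (n - (j + 1)) G" by (simp only: diff_diff_eq)
  with G(2) show ?thesis by (auto simp: K0_def)
qed

text \<open>
  \<open>V\<close> relates \<open>j\<close> to the values that finite approximations from \<open>C\<close> assign to it. Existence extends an
  approximation by one pair; uniqueness compares two approximations at \<open>j + 1\<close> through their values at
  \<open>j\<close>. The predicate \<open>legal\<close> bounds the recursion: it is trivial for powers, and says \<open>j \<le> n\<close> for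
  products over sequences of length \<open>n\<close>. One step is given by a
  relation, because the entries of a sequence are accessible only through its graph.
\<close>
lemma recursion:
  fixes C :: "'c set" and rel :: "'c \<Rightarrow> 'a \<Rightarrow> 'a \<Rightarrow> bool"
    and step :: "'a \<Rightarrow> 'a \<Rightarrow> 'a \<Rightarrow> bool" and legal :: "'a \<Rightarrow> bool"
    and V :: "'a \<Rightarrow> 'a \<Rightarrow> bool"
  assumes V_def: "\<And>j y. V j y \<longleftrightarrow> (\<exists>c \<in> C. approx step (rel c) \<and> rel c j y)"
    and V: "definable2 mem V" and legal: "definable1 mem legal"
    and empty: "\<exists>c \<in> C. \<forall>i z. \<not> rel c i z"
    and insert: "\<And>c j y. c \<in> C \<Longrightarrow> j \<in> kN mem \<Longrightarrow> legal j \<Longrightarrow>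
      \<exists>c' \<in> C. \<forall>i z. rel c' i z \<longleftrightarrow> rel c i z \<or> i = j \<and> z = y"
    and legal_0: "legal 0" and legal_Suc: "\<And>j. j \<in> kN mem \<Longrightarrow> legal (j + 1) \<Longrightarrow> legal j"
    and step: "\<And>j w. j \<in> kN mem \<Longrightarrow> legal (j + 1) \<Longrightarrow> \<exists>!z. step j w z"
  shows "V 0 1"
    and "\<And>j y z. j \<in> kN mem \<Longrightarrow> legal (j + 1) \<Longrightarrow> V j y \<Longrightarrow> step j y z \<Longrightarrow> V (j + 1) z"
    and "\<And>j. j \<in> kN mem \<Longrightarrow> legal j \<Longrightarrow> \<exists>!y. V j y"
proof -
  show V0: "V 0 1"
  proof -
    obtain c where c: "c \<in> C" "\<forall>i z. \<not> rel c i z" using empty by blast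
    obtain c' where "c' \<in> C" "\<forall>i z. rel c' i z \<longleftrightarrow> rel c i z \<or> i = 0 \<and> z = 1"
      using insert[OF c(1) zero_nat legal_0] by blast
    with c(2) show ?thesis unfolding V_def by (intro bexI[of _ c']) (auto simp: approx_def)
  qed
  show VS: "V (j + 1) z" if j: "j \<in> kN mem" "legal (j + 1)" and y: "V j y" "step j y z" for j y z
  proof -
    obtain c where c: "c \<in> C" "approx step (rel c)" "rel c j y" using y(1) by (auto simp: V_def)
    obtain c' where c': "c' \<in> C" "\<forall>i w. rel c' i w \<longleftrightarrow> rel c i w \<or> i = j + 1 \<and> w = z"
      using insert[OF c(1) Suc_nat[OF j(1)] j(2)] by blast
    have "approx step (rel c')"
      unfolding approx_def
    proof (intro allI impI)
      fix i w assume "rel c' i w"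
      then consider "rel c i w" | "i = j + 1" "w = z" using c'(2) by blast
      then show "i = 0 \<and> w = 1 \<or> i \<noteq> 0 \<and> (\<exists>v. rel c' (i - 1) v \<and> step (i - 1) v w)"
      proof cases
        case 1
        then show ?thesis using c(2) c'(2) unfolding approx_def by metis
      next
        case 2
        then show ?thesis using c(3) c'(2) y(2) Suc_neq_zero[OF j(1)] by auto
      qed
    qed
    then show ?thesis using c' unfolding V_def by blast
  qed
  have VSE: "\<exists>w. V j w \<and> step j w y" if j: "j \<in> kN mem" and y: "V (j + 1) y" for j y
  proof -
    obtain c where c: "c \<in> C" "approx step (rel c)" "rel c (j + 1) y" using y by (auto simp: V_def)
    then have "\<exists>w. rel c (j + 1 - 1) w \<and> step (j + 1 - 1) w y"
      using Suc_neq_zero[OF j] unfolding approx_def by blast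
    with c show ?thesis by (auto simp: V_def)
  qed
  show "\<exists>!y. V j y" if j: "j \<in> kN mem" "legal j" for j
  proof -
    have "legal j \<longrightarrow> (\<exists>y. V j y) \<and> (\<forall>y y'. V j y \<longrightarrow> V j y' \<longrightarrow> y = y')"
      using j(1)
    proof (rule nat_induct)
      show "definable1 mem (\<lambda>j. legal j \<longrightarrow> (\<exists>y. V j y) \<and> (\<forall>y y'. V j y \<longrightarrow> V j y' \<longrightarrow> y = y'))"
        unfolding definable1_def
        by (intro def_pred_rules definable1_app[OF legal] definable2_app[OF V] term_rules)
      have "y = 1" if "V 0 y" for y using that by (auto simp: V_def approx_def)
      then show "legal 0 \<longrightarrow> (\<exists>y. V 0 y) \<and> (\<forall>y y'. V 0 y \<longrightarrow> V 0 y' \<longrightarrow> y = y')"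
        using V0 by blast
    next
      fix m assume m: "m \<in> kN mem"
        and IH: "legal m \<longrightarrow> (\<exists>y. V m y) \<and> (\<forall>y y'. V m y \<longrightarrow> V m y' \<longrightarrow> y = y')"
      show "legal (m + 1) \<longrightarrow> (\<exists>y. V (m + 1) y) \<and>
        (\<forall>y y'. V (m + 1) y \<longrightarrow> V (m + 1) y' \<longrightarrow> y = y')"
      proof
        assume d: "legal (m + 1)"
        then obtain y where "V m y" using IH legal_Suc[OF m] by blast
        moreover obtain z where "step m y z" using step[OF m d] by blast
        ultimately have "V (m + 1) z" using VS[OF m d] by blast
        moreover have "y = y'" if "V (m + 1) y" "V (m + 1) y'" for y y'
          using VSE[OF m that(1)] VSE[OF m that(2)] IH legal_Suc[OF m d] step[OF m d] by metis
        ultimately show "(\<exists>y. V (m + 1) y) \<and> (\<forall>y y'. V (m + 1) y \<longrightarrow> V (m + 1) y' \<longrightarrow> y = y')"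
          by blast
      qed
    qed
    with j(2) show ?thesis by blast
  qed
qed

section \<open>Powers\<close>

definition pow_val :: "'a \<Rightarrow> 'a \<Rightarrow> 'a \<Rightarrow> bool" where
  "pow_val x n y \<longleftrightarrow> (\<exists>A B G t. approx (\<lambda>_ w z. z = w * x) (pair_mem mem A B G t) \<and>
     pair_mem mem A B G t n y)"

lemma def_pred_pow_val:
  assumes "field_term mem ss f" "field_term mem ss g" "field_term mem ss h"
  shows "def_pred (keq mem) ss (\<lambda>xs. pow_val (f xs) (g xs) (h xs))"
  unfolding pow_val_def approx_def pair_mem_def
  by (intro def_pred_rules term_rules assms)

lemma pow_val_recursion:
  shows "pow_val x 0 1"
    and "n \<in> kN mem \<Longrightarrow> pow_val x n y \<Longrightarrow> pow_val x (n + 1) (y * x)"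
    and "n \<in> kN mem \<Longrightarrow> \<exists>!y. pow_val x n y"
proof -
  let ?rel = "\<lambda>(A, B, G, t). pair_mem mem A B G t"
  have 0: "pow_val x n y \<longleftrightarrow>
      (\<exists>c \<in> UNIV. approx (\<lambda>_ w z. z = w * x) (?rel c) \<and> ?rel c n y)" for n y
    by (auto simp: pow_val_def)
  have 1: "definable2 mem (pow_val x)"
    unfolding definable2_def by (intro def_pred_pow_val term_rules)
  have 2: "definable1 mem (\<lambda>_. True)"
    using def_pred_eq[OF field_term_const field_term_const, of mem "[SK]" 0 0]
    by (simp add: definable1_def)
  have 3: "\<exists>c \<in> UNIV. \<forall>i z. \<not> ?rel c i z" using pair_mem_empty by auto
  have 4: "\<exists>c' \<in> UNIV. \<forall>i z. ?rel c' i z \<longleftrightarrow> ?rel c i z \<or> i = j \<and> z = y" for c j y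
    using pair_mem_insert[of _ _ _ _ j y] by (cases c) auto
  note rec = recursion[where V = "pow_val x" and rel = ?rel, OF 0 1 2 3 4]
  show "pow_val x 0 1" by (rule rec) auto
  show "pow_val x (n + 1) (y * x)" if "n \<in> kN mem" "pow_val x n y"
    by (rule rec(2)) (use that in auto)
  show "\<exists>!y. pow_val x n y" if "n \<in> kN mem" by (rule rec(3)) (use that in auto)
qed

lemma ex_definable_power:
  "\<exists>pow :: 'a \<Rightarrow> 'a \<Rightarrow> 'a.
     definable (keq mem) [SK, SK, SK] {[kel n, kel x, kel (pow n x)] | n x. n \<in> kN mem} \<and>
     (\<forall>x. pow 0 x = 1) \<and> (\<forall>x. \<forall>n \<in> kN mem. pow (n + 1) x = pow n x * x)"
proof (intro exI conjI allI ballI)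
  define pow where "pow = (\<lambda>n x. THE y. pow_val x n y)"
  have pow: "pow n x = y \<longleftrightarrow> pow_val x n y" if "n \<in> kN mem" for n x y
    using pow_val_recursion(3)[OF that, of x] theI'[of "pow_val x n"]
    unfolding pow_def by blast
  show "pow 0 x = 1" for x using pow zero_nat pow_val_recursion(1) by blast
  show "pow (n + 1) x = pow n x * x" if "n \<in> kN mem" for n x
    using pow that Suc_nat pow_val_recursion(2) by blast
  let ?X = "{[kel n, kel x, kel (pow n x)] | n x. n \<in> kN mem}"
  show "definable (keq mem) [SK, SK, SK] ?X"
  proof (rule def_pred_definable)
    have "def_pred (keq mem) [SK, SK, SK] (\<lambda>xs. kval (hd xs) \<in> kN mem \<and>
      pow_val (kval (hd (tl xs))) (kval (hd xs)) (kval (hd (tl (tl xs)))))"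
      by (intro def_pred_rules def_pred_pow_val term_rules)
    then show "def_pred (keq mem) [SK, SK, SK] (\<lambda>xs. xs \<in> ?X)"
      by (rule def_pred.cong) (auto simp: tuples_Cons tuples_Nil univ_keq pow[symmetric])
  qed (auto simp: tuples_Cons tuples_Nil univ_keq)
qed

end

section \<open>Iterated products\<close>

locale uniform_sequences = char_zero_field mem
  for mem :: "'a::field \<Rightarrow> 'b \<Rightarrow> bool" +
  fixes tt :: "keqsort list"
    and F :: "'a \<Rightarrow> ('a, 'b) keqelem list set"
    and R :: "'a \<Rightarrow> (('a, 'b) keqelem list \<times> ('a, 'b) keqelem list) set"
  assumes uniform: "uniform_power_sets mem tt F R"
begin

lemma power_set: "n \<in> kN mem \<Longrightarrow> definable_finite_power_set (keq mem)
    [SK, SK] {[kel i, kel x] | i x. i \<in> kseg mem n} tt (F n) (R n)"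
  using uniform by (simp add: uniform_power_sets_def)

lemma sorts_tt: "set tt \<subseteq> sorts (keq mem)"
  using power_set[OF zero_nat] by (simp add: definable_finite_power_set_def definable_def)

lemma F_tuples:
  assumes "n \<in> kN mem"
  shows "F n \<subseteq> tuples (keq mem) tt"
proof -
  have "definable (keq mem) tt (F n)"
    using power_set[OF assms] unfolding definable_finite_power_set_def by (elim conjE)
  then show ?thesis by (auto simp: definable_def)
qed

lemma R_kseg: "n \<in> kN mem \<Longrightarrow> ([kel i, kel x], S) \<in> R n \<Longrightarrow> i \<in> kseg mem n \<and> S \<in> F n"
  using power_set[of n] by (auto simp: definable_finite_power_set_def)

text \<open>
  The condition \<open>n \<in> N\<close> is included because \<open>R n\<close> is unspecified for other \<open>n\<close>; it makes the relation
  definable in all arguments together.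
\<close>
definition entry :: "'a \<Rightarrow> ('a, 'b) keqelem list \<Rightarrow> 'a \<Rightarrow> 'a \<Rightarrow> bool" where
  "entry n S i x \<longleftrightarrow> n \<in> kN mem \<and> ([kel i, kel x], S) \<in> R n"

lemma ex_empty_set:
  assumes "n \<in> kN mem"
  shows "\<exists>S \<in> F n. \<forall>i x. \<not> entry n S i x"
proof -
  obtain S where "S \<in> F n" "\<forall>x \<in> {[kel i, kel x] | i x. i \<in> kseg mem n}. (x, S) \<notin> R n"
    using power_set[OF assms] unfolding definable_finite_power_set_def by (elim exE conjE) (rule that)
  note S = this
  have "\<not> entry n S i x" for i x
  proof
    assume "entry n S i x"
    then have *: "([kel i, kel x], S) \<in> R n" by (simp add: entry_def)
    have "[kel i, kel x] \<in> {[kel i, kel x] | i x. i \<in> kseg mem n}"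
      using R_kseg[OF assms *] by blast
    from S(2)[THEN bspec, OF this] * show False by (rule notE)
  qed
  with S(1) show ?thesis by blast
qed

lemma ex_insert_set:
  assumes "n \<in> kN mem" "S \<in> F n" "j \<in> kseg mem n"
  shows "\<exists>T \<in> F n. \<forall>i x. entry n T i x \<longleftrightarrow> entry n S i x \<or> i = j \<and> x = y"
proof -
  let ?X = "{[kel i, kel x] | i x. i \<in> kseg mem n}"
  obtain sing un where
    sing: "\<forall>a \<in> ?X. sing a \<in> F n \<and> (\<forall>x \<in> ?X. (x, sing a) \<in> R n \<longleftrightarrow> x = a)" and
    un: "\<forall>B \<in> F n. \<forall>C \<in> F n. un B C \<in> F n \<and>
      (\<forall>x \<in> ?X. (x, un B C) \<in> R n \<longleftrightarrow> (x, B) \<in> R n \<or> (x, C) \<in> R n)"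
    using power_set[OF assms(1)] unfolding definable_finite_power_set_def
    by (elim exE conjE) (rule that)
  have X: "[kel j, kel y] \<in> ?X" using assms(3) by blast
  let ?T = "un S (sing [kel j, kel y])"
  note sing_y = sing[THEN bspec, OF X]
  note T = un[THEN bspec, OF assms(2), THEN bspec, OF conjunct1[OF sing_y]]
  have "entry n ?T i x \<longleftrightarrow> entry n S i x \<or> i = j \<and> x = y" for i x
  proof (cases "i \<in> kseg mem n")
    case True
    then have ix: "[kel i, kel x] \<in> ?X" by blast
    have "([kel i, kel x], ?T) \<in> R n \<longleftrightarrow>
        ([kel i, kel x], S) \<in> R n \<or> i = j \<and> x = y"
      using conjunct2[OF T, THEN bspec, OF ix] conjunct2[OF sing_y, THEN bspec, OF ix]
      by simp
    with assms(1) show ?thesis by (simp add: entry_def)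
  next
    case False
    then show ?thesis using R_kseg assms(3) by (auto simp: entry_def)
  qed
  with conjunct1[OF T] show ?thesis by (intro bexI[of _ ?T]) simp_all
qed

lemma def_pred_F:
  assumes "field_term mem ss n" "term_tuple (keq mem) ss tt S"
  shows "def_pred (keq mem) ss (\<lambda>xs. n xs \<in> kN mem \<and> S xs \<in> F (n xs))"
proof -
  have "definable (keq mem) (SK # tt) {kel n # y | n y. n \<in> kN mem \<and> y \<in> F n}"
    using uniform by (simp add: uniform_power_sets_def)
  from def_pred_comp[OF closed_struct_keq definable_def_pred[OF closed_struct_keq this]
      term_tuple_Cons[OF assms(1)[unfolded field_term_def] assms(2)]]
  show ?thesis by simp
qed

lemma def_pred_entry:
  assumes "field_term mem ss n" "term_tuple (keq mem) ss tt S" "field_term mem ss f"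
    "field_term mem ss g"
  shows "def_pred (keq mem) ss (\<lambda>xs. entry (n xs) (S xs) (f xs) (g xs))"
proof -
  let ?R = "{kel n # x @ y | n x y. n \<in> kN mem \<and> (x, y) \<in> R n}"
  have "definable (keq mem) (SK # [SK, SK] @ tt) ?R"
    using uniform by (simp add: uniform_power_sets_def)
  moreover have "term_tuple (keq mem) ss (SK # [SK, SK] @ tt)
    (\<lambda>xs. kel (n xs) # kel (f xs) # kel (g xs) # S xs)"
    using assms by (auto simp: field_term_def intro!: term_tuple_Cons)
  ultimately have "def_pred (keq mem) ss (\<lambda>xs. kel (n xs) # kel (f xs) # kel (g xs) # S xs \<in> ?R)"
    by (rule def_pred_comp[OF closed_struct_keq definable_def_pred[OF closed_struct_keq]])
  then show ?thesis
  proof (rule def_pred.cong)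
    fix xs
    have "\<exists>i x. u = [kel i, kel x]" if "m \<in> kN mem" "(u, v) \<in> R m" for m u v
      using power_set[OF that(1)] that(2) by (auto simp: definable_finite_power_set_def)
    note pair = this
    show "entry (n xs) (S xs) (f xs) (g xs) \<longleftrightarrow> kel (n xs) # kel (f xs) # kel (g xs) # S xs \<in> ?R"
    proof
      assume "entry (n xs) (S xs) (f xs) (g xs)"
      then show "kel (n xs) # kel (f xs) # kel (g xs) # S xs \<in> ?R"
        unfolding entry_def
        by (intro CollectI exI[of _ "n xs"] exI[of _ "[kel (f xs), kel (g xs)]"] exI[of _ "S xs"])
           simp
    next
      assume "kel (n xs) # kel (f xs) # kel (g xs) # S xs \<in> ?R"
      then obtain m u v where m: "kel (n xs) # kel (f xs) # kel (g xs) # S xs = kel m # u @ v"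
        "m \<in> kN mem" "(u, v) \<in> R m" by blast
      from pair[OF m(2,3)] obtain i x where "u = [kel i, kel x]" by blast
      with m show "entry (n xs) (S xs) (f xs) (g xs)" by (simp add: entry_def)
    qed
  qed
qed

definition prod_step :: "'a \<Rightarrow> ('a, 'b) keqelem list \<Rightarrow> 'a \<Rightarrow> 'a \<Rightarrow> 'a \<Rightarrow> bool" where
  "prod_step n h i w z \<longleftrightarrow> (\<exists>v. entry n h i v \<and> z = w * v)"

text \<open>
  Products over a sequence of length \<open>n\<close> have \<open>n + 1\<close> partial products, with indices up to \<open>n\<close>; so the
  approximations are elements of the power set of \<open>(n + 1) \<times> K\<close>.
\<close>
definition prod_val :: "'a \<Rightarrow> ('a, 'b) keqelem list \<Rightarrow> 'a \<Rightarrow> 'a \<Rightarrow> bool" where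
  "prod_val n h j y \<longleftrightarrow> (\<exists>S \<in> tuples (keq mem) tt. (n + 1 \<in> kN mem \<and> S \<in> F (n + 1)) \<and>
     approx (prod_step n h) (entry (n + 1) S) \<and> entry (n + 1) S j y)"

lemma def_pred_prod_val:
  assumes "field_term mem ss n" "term_tuple (keq mem) ss tt h" "field_term mem ss f"
    "field_term mem ss g"
  shows "def_pred (keq mem) ss (\<lambda>xs. prod_val (n xs) (h xs) (f xs) (g xs))"
  unfolding prod_val_def approx_def prod_step_def
  by (rule def_pred_ex_tuple[OF sorts_tt])
    (intro def_pred_F def_pred_entry def_pred_rules term_rules assms term_tuple_take
      term_tuple_drop term_tuple_tl)

lemma entry_kapp:
  assumes "n \<in> kN mem" "h \<in> kseqs mem F R n" "i \<in> kseg mem n"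
  shows "entry n h i v \<longleftrightarrow> v = kapp R n h i"
proof -
  have ex1: "\<exists>!x. ([kel i, kel x], h) \<in> R n" using assms by (simp add: kseqs_def)
  then show ?thesis
    using theI'[OF ex1] assms(1) by (auto simp: entry_def kapp_def)
qed

lemma prod_val_recursion:
  assumes n: "n \<in> kN mem" and h: "h \<in> kseqs mem F R n"
  shows "prod_val n h 0 1"
    and "j \<in> kseg mem n \<Longrightarrow> prod_val n h j y \<Longrightarrow> prod_val n h (j + 1) (y * kapp R n h j)"
    and "j \<in> kN mem \<Longrightarrow> n - j \<in> kN mem \<Longrightarrow> \<exists>!y. prod_val n h j y"
proof -
  note n1 = Suc_nat[OF n]
  have 0: "prod_val n h j y \<longleftrightarrow>
      (\<exists>S \<in> F (n + 1). approx (prod_step n h) (entry (n + 1) S) \<and> entry (n + 1) S j y)" for j y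
    using F_tuples[OF n1] n1 by (auto simp: prod_val_def)
  have hF: "h \<in> tuples (keq mem) tt" using h F_tuples[OF n] by (auto simp: kseqs_def)
  have 1: "definable2 mem (prod_val n h)"
    unfolding definable2_def
    by (intro def_pred_prod_val term_rules term_tuple_const sorts_tt hF)
  have 2: "definable1 mem (\<lambda>j. n - j \<in> kN mem)"
    unfolding definable1_def by (intro def_pred_rules term_rules)
  note 3 = ex_empty_set[OF n1]
  have 4: "\<exists>T \<in> F (n + 1). \<forall>i x. entry (n + 1) T i x \<longleftrightarrow> entry (n + 1) S i x \<or> i = j \<and> x = y"
    if "S \<in> F (n + 1)" "j \<in> kN mem" "n - j \<in> kN mem" for S j y
    using ex_insert_set[OF n1 that(1) kseg_Suc[OF that(2,3)]] .
  have 5: "n - 0 \<in> kN mem" using n by simp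
  have 6: "n - j \<in> kN mem" if "j \<in> kN mem" "n - (j + 1) \<in> kN mem" for j
    using kseg_if_Suc_le[OF that] by (simp add: kseg_iff)
  have 7: "\<exists>!z. prod_step n h j w z" if "j \<in> kN mem" "n - (j + 1) \<in> kN mem" for j w
    using entry_kapp[OF n h kseg_if_Suc_le[OF that]] by (simp add: prod_step_def)
  note rec = recursion[where V = "prod_val n h" and rel = "entry (n + 1)", OF 0 1 2 3 4 5 6 7]
  show "prod_val n h 0 1" by (rule rec)
  show "prod_val n h (j + 1) (y * kapp R n h j)" if j: "j \<in> kseg mem n" "prod_val n h j y"
  proof -
    have "prod_step n h j y (y * kapp R n h j)"
      using entry_kapp[OF n h j(1)] by (simp add: prod_step_def)
    moreover have "j \<in> kN mem" using j(1) by (simp add: kseg_iff)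
    ultimately show ?thesis
      by (intro rec(2)) (assumption | rule Suc_le_if_kseg j)+
  qed
  show "\<exists>!y. prod_val n h j y" if "j \<in> kN mem" "n - j \<in> kN mem" by (rule rec(3)) (assumption | rule that)+
qed

lemma def_pred_kseqs:
  assumes "field_term mem ss n" "term_tuple (keq mem) ss tt h"
  shows "def_pred (keq mem) ss (\<lambda>xs. n xs \<in> kN mem \<and> h xs \<in> kseqs mem F R (n xs))"
proof -
  have "def_pred (keq mem) ss (\<lambda>xs. (n xs \<in> kN mem \<and> h xs \<in> F (n xs)) \<and>
    (\<forall>i. i \<in> kN mem \<and> n xs - i \<in> kN mem \<and> \<not> i = n xs \<longrightarrow>
      (\<exists>x. entry (n xs) (h xs) i x \<and> (\<forall>y. entry (n xs) (h xs) i y \<longrightarrow> y = x))))"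
    by (intro def_pred_F def_pred_entry def_pred_rules term_rules assms term_tuple_tl)
  then show ?thesis
    by (rule def_pred.cong) (auto simp: kseqs_def kseg_iff entry_def Ex1_def)
qed

lemma ex_definable_iprod:
  "\<exists>iprod :: 'a \<Rightarrow> ('a, 'b) keqelem list \<Rightarrow> 'a \<Rightarrow> 'a.
     definable (keq mem) (SK # tt @ [SK, SK])
       {kel n # h @ [kel j, kel (iprod n h j)] | n h j.
          n \<in> kN mem \<and> h \<in> kseqs mem F R n \<and> j \<in> kN mem \<and> kle mem j n} \<and>
     (\<forall>n \<in> kN mem. \<forall>h \<in> kseqs mem F R n.
        iprod n h 0 = 1 \<and>
        (\<forall>j \<in> kseg mem n. iprod n h (j + 1) = iprod n h j * kapp R n h j))"
proof (intro exI conjI ballI)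
  define iprod where "iprod = (\<lambda>n h j. THE y. prod_val n h j y)"
  have iprod: "iprod n h j = y \<longleftrightarrow> prod_val n h j y"
    if "n \<in> kN mem" "h \<in> kseqs mem F R n" "j \<in> kN mem" "n - j \<in> kN mem" for n h j y
    using prod_val_recursion(3)[OF that] theI'[of "prod_val n h j"]
    unfolding iprod_def by blast
  show "iprod n h 0 = 1" if "n \<in> kN mem" "h \<in> kseqs mem F R n" for n h
    using iprod[OF that] zero_nat that prod_val_recursion(1)[OF that] by simp
  show "iprod n h (j + 1) = iprod n h j * kapp R n h j"
    if "n \<in> kN mem" "h \<in> kseqs mem F R n" "j \<in> kseg mem n" for n h j
  proof -
    have j: "j \<in> kN mem" "n - j \<in> kN mem" using that(3) by (auto simp: kseg_iff)
    have "prod_val n h j (iprod n h j)" using iprod[OF that(1,2) j, of "iprod n h j"] by simp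
    from prod_val_recursion(2)[OF that this] show ?thesis
      using iprod[OF that(1,2) Suc_nat[OF j(1)] Suc_le_if_kseg[OF that(3)]] by simp
  qed
  let ?X = "{kel n # h @ [kel j, kel (iprod n h j)] | n h j.
    n \<in> kN mem \<and> h \<in> kseqs mem F R n \<and> j \<in> kN mem \<and> kle mem j n}"
  let ?ss = "SK # tt @ [SK, SK]"
  have h_tuple: "h \<in> tuples (keq mem) tt" if "n \<in> kN mem" "h \<in> kseqs mem F R n" for n h
    using that F_tuples by (auto simp: kseqs_def)
  show "definable (keq mem) ?ss ?X"
  proof (rule def_pred_definable)
    show "set ?ss \<subseteq> sorts (keq mem)" using sorts_tt by simp
    show "?X \<subseteq> tuples (keq mem) ?ss"
      using h_tuple by (fastforce simp: tuples_Cons tuples_Nil tuples_append univ_keq)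
    let ?n = "\<lambda>xs. kval (hd xs)" and ?h = "\<lambda>xs. take (length tt) (tl xs)"
      and ?j = "\<lambda>xs. kval (hd (drop (length tt) (tl xs)))"
      and ?y = "\<lambda>xs. kval (hd (tl (drop (length tt) (tl xs))))"
    have j: "field_term mem ?ss ?j" and y: "field_term mem ?ss ?y"
      by (intro field_term_tl field_term_drop field_term_hd)+
    have h: "term_tuple (keq mem) ?ss tt ?h" by (intro term_tuple_tl term_tuple_take)
    have "def_pred (keq mem) ?ss (\<lambda>xs. (?n xs \<in> kN mem \<and> ?h xs \<in> kseqs mem F R (?n xs)) \<and>
      ?j xs \<in> kN mem \<and> ?n xs - ?j xs \<in> kN mem \<and> prod_val (?n xs) (?h xs) (?j xs) (?y xs))"
      by (intro def_pred_kseqs def_pred_prod_val def_pred_rules field_term_diff field_term_hd j y h)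
    then show "def_pred (keq mem) ?ss (\<lambda>xs. xs \<in> ?X)"
    proof (rule def_pred.cong)
      fix xs assume "xs \<in> tuples (keq mem) ?ss"
      then obtain n h j y where xs: "xs = kel n # h @ [kel j, kel y]" "h \<in> tuples (keq mem) tt"
        by (auto simp: tuples_Cons tuples_Nil tuples_append univ_keq)
      then have len: "length h = length tt" by (simp add: tuples_length)
      have "xs \<in> ?X \<longleftrightarrow> n \<in> kN mem \<and> h \<in> kseqs mem F R n \<and> j \<in> kN mem \<and> kle mem j n \<and>
          y = iprod n h j"
        unfolding xs(1) by auto
      also have "\<dots> \<longleftrightarrow> (n \<in> kN mem \<and> h \<in> kseqs mem F R n) \<and>
          j \<in> kN mem \<and> n - j \<in> kN mem \<and> prod_val n h j y"
        unfolding kle_def using iprod by metis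
      finally show "xs \<in> ?X \<longleftrightarrow> (?n xs \<in> kN mem \<and> ?h xs \<in> kseqs mem F R (?n xs)) \<and>
        ?j xs \<in> kN mem \<and> ?n xs - ?j xs \<in> kN mem \<and>
        prod_val (?n xs) (?h xs) (?j xs) (?y xs)"
        by (simp add: xs(1) len)
    qed
  qed
qed

end

theorem proposition7p11:
  fixes mem :: "'a::field \<Rightarrow> 'b \<Rightarrow> bool"
  assumes "finite_power_field mem"
    and "definable_char_zero mem"
  shows
    "(\<exists>pow :: 'a \<Rightarrow> 'a \<Rightarrow> 'a.
        definable (keq mem) [SK, SK, SK] {[kel n, kel x, kel (pow n x)] | n x. n \<in> kN mem} \<and>
        (\<forall>x. pow 0 x = 1) \<and>
        (\<forall>x. \<forall>n \<in> kN mem. pow (n + 1) x = pow n x * x)) \<and>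
     (\<forall>tt F R. uniform_power_sets mem tt F R \<longrightarrow>
        (\<exists>iprod :: 'a \<Rightarrow> ('a, 'b) keqelem list \<Rightarrow> 'a \<Rightarrow> 'a.
           definable (keq mem) (SK # tt @ [SK, SK])
             {kel n # h @ [kel j, kel (iprod n h j)] | n h j.
                n \<in> kN mem \<and> h \<in> kseqs mem F R n \<and> j \<in> kN mem \<and> kle mem j n} \<and>
           (\<forall>n \<in> kN mem. \<forall>h \<in> kseqs mem F R n.
              iprod n h 0 = 1 \<and>
              (\<forall>j \<in> kseg mem n. iprod n h (j + 1) = iprod n h j * kapp R n h j))))"
proof -
  interpret char_zero_field mem using assms by unfold_locales
  show ?thesis
  proof (intro conjI allI impI)
    fix tt F R assume "uniform_power_sets mem tt F R"
    then interpret uniform_sequences mem tt F R by unfold_locales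
    show "\<exists>iprod :: 'a \<Rightarrow> ('a, 'b) keqelem list \<Rightarrow> 'a \<Rightarrow> 'a.
           definable (keq mem) (SK # tt @ [SK, SK])
             {kel n # h @ [kel j, kel (iprod n h j)] | n h j.
                n \<in> kN mem \<and> h \<in> kseqs mem F R n \<and> j \<in> kN mem \<and> kle mem j n} \<and>
           (\<forall>n \<in> kN mem. \<forall>h \<in> kseqs mem F R n.
              iprod n h 0 = 1 \<and>
              (\<forall>j \<in> kseg mem n. iprod n h (j + 1) = iprod n h j * kapp R n h j))"
      by (rule ex_definable_iprod)
  qed (rule ex_definable_power)
qed

end
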